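(* Let $X=\{x_0^4-x_0x_1^3-x_2^4+x_2x_3^3=0\}\subset\mathbb{P}^3_{\mathbb{C}}$ be the Schur quartic, let $D=\sum_{j=1}^{24}L_j$ be the divisor on $X$ formed by the $24$ explicit lines listed in the context, and let $\alpha=\operatorname{diag}(1,1,i,i)\in\operatorname{PGL}_4(\mathbb{C})$ with $i^2=-1$, which is a projective automorphism of $X$. The divisors $D$ and $D^*=\alpha(D)$ have no common component. Their union is the configuration $\mathcal{C}_2$ of the $48$ lines of the second kind on the Schur quartic. The incidence data decompose as follows, where $n$ is the number of lines and $t_r$ is the number of points lying on exactly $r$ of the lines: - $D$: $n=24$, $t_2=0$, $t_3=32$, $t_4=0$; - $D^*$: $n=24$, $t_2=0$, $t_3=32$, $t_4=0$; - $D+D^*$: $n=48$, $t_2=144$, $t_3=64$, $t_4=0$. The $64$ triple points of $\mathcal{C}_2$ are the two disjoint sets of internal triple points (the triple points of $D$ and the triple points of $D^*$), while all $144$ double points are intersections of one line from each half. Moreover, $\alpha(D)=D^*$ and $\alpha(D^* )=D$, so the halves are equivalent under $\operatorname{Aut}(X)$.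
   Context: Fix $\tau\in\mathbb{C}$ with $\tau^2=-3$. For $a,b,c,d\in\mathbb{Q}(\tau)$ let $L(a,b;c,d)$ be the projective line spanned by $(1,0,a,b)$ and $(0,1,c,d)$, i.e. the image of $[s:t]\mapsto[s:t:as+ct:bs+dt]$. The lines $L_j=L(a,b;c,d)$ are: - $L_1=L(1,0;0,1)$ - $L_2=L(-1,0;0,-1)$ - $L_3=L(-1,0;0,(1-\tau)/2)$ - $L_4=L(-1,0;0,(1+\tau)/2)$ - $L_5=L(1,0;0,-(1+\tau)/2)$ - $L_6=L(1,0;0,(-1+\tau)/2)$ - $L_7=L(-\tau/3,-1-\tau/3;(-3-\tau)/6,(3-\tau)/6)$ - $L_8=L(-\tau/3,2\tau/3;(3-\tau)/6,(3-\tau)/6)$ - $L_9=L(-\tau/3,1-\tau/3;\tau/3,(3-\tau)/6)$ - $L_{10}=L(\tau/3,-1+\tau/3;(-3+\tau)/6,(3+\tau)/6)$ - $L_{11}=L(\tau/3,-2\tau/3;(3+\tau)/6,(3+\tau)/6)$ - $L_{12}=L(\tau/3,1+\tau/3;-\tau/3,(3+\tau)/6)$ - $L_{13}=L(\tau/3,-1+\tau/3;(3+\tau)/6,-\tau/3)$ - $L_{14}=L(\tau/3,-2\tau/3;-\tau/3,-\tau/3)$ - $L_{15}=L(\tau/3,1+\tau/3;(-3+\tau)/6,-\tau/3)$ - $L_{16}=L(-\tau/3,-1-\tau/3;(3-\tau)/6,\tau/3)$ - $L_{17}=L(-\tau/3,2\tau/3;\tau/3,\tau/3)$ - $L_{18}=L(-\tau/3,1-\tau/3;(-3-\tau)/6,\tau/3)$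 - $L_{19}=L(-\tau/3,-1-\tau/3;\tau/3,(-3-\tau)/6)$ - $L_{20}=L(-\tau/3,2\tau/3;(-3-\tau)/6,(-3-\tau)/6)$ - $L_{21}=L(-\tau/3,1-\tau/3;(3-\tau)/6,(-3-\tau)/6)$ - $L_{22}=L(\tau/3,-1+\tau/3;-\tau/3,(-3+\tau)/6)$ - $L_{23}=L(\tau/3,-2\tau/3;(-3+\tau)/6,(-3+\tau)/6)$ - $L_{24}=L(\tau/3,1+\tau/3;(3+\tau)/6,(-3+\tau)/6)$ "Line of the second kind" is the established notion of the literature on lines on quartic surfaces (Segre, Rams–Schütt, Veniani): for a line $\ell$ on a smooth quartic surface, each plane containing $\ell$ cuts the surface in $\ell$ together with a residual plane cubic; $\ell$ is of the second kind if the resultant of the restrictions to $\ell$ of the residual cubic and of its Hessian vanishes identically as the plane varies in the pencil of planes containing $\ell$ (so that $\ell$ meets the smooth residual cubics in inflection points).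
   Formalization: The 48 lines are proved to be exactly the lines of the first kind (not of the second kind) on the Schur quartic; "second kind" is false under the stated definition, e.g. for L_1 in the plane x_3=x_1 the cubic t^3-4s^3 and its Hessian 288s^2t share no zero. *)

theory Defs
  imports
    "HOL-Analysis.Analysis"
    "HOL-Library.Multiset"
    "Subresultants.Resultant_Prelim"
begin

no_notation Matrix.vec_index (infixl "$" 100)

text \<open>
  Points of $P^3$ are the one-dimensional subspaces of $C^4$, and linear subvarieties are sets of
  points. The type \<^typ>\<open>4\<close> is indexed by \<open>1, 2, 3, 4\<close>, so the homogeneous coordinate $x_k$
  is the component \<open>k + 1\<close>. The linear algebra is the complex one (\<open>vec.span\<close>, \<open>vec.dim\<close>),
  not the real one that \<^typ>\<open>complex^4\<close> also carries.
\<close>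

type_synonym point = "(complex^4) set"

definition projectivization :: "(complex^4) set \<Rightarrow> point set" where
  "projectivization W = {vec.span {v} | v. v \<in> W \<and> v \<noteq> 0}"

definition P3 :: "point set" where
  "P3 = projectivization UNIV"

definition is_line :: "point set \<Rightarrow> bool" where
  "is_line l \<longleftrightarrow> (\<exists>W. vec.subspace W \<and> vec.dim W = 2 \<and> l = projectivization W)"

text \<open>The form \<open>F\<close> is given as a function; below it is always a homogeneous quartic.\<close>

definition zero_locus :: "(complex^4 \<Rightarrow> complex) \<Rightarrow> point set" where
  "zero_locus F = {vec.span {v} | v. v \<noteq> 0 \<and> F v = 0}"

definition lines_on :: "(complex^4 \<Rightarrow> complex) \<Rightarrow> point set set" where
  "lines_on F = {l. is_line l \<and> l \<subseteq> zero_locus F}"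

definition schur :: "complex^4 \<Rightarrow> complex" where
  "schur x = (x$1)^4 - x$1 * (x$2)^3 - (x$3)^4 + x$3 * (x$4)^3"


text \<open>
  Lines of the second kind. A plane containing the line spanned by \<open>u, v\<close> is spanned by
  \<open>u, v, m\<close>, with coordinates \<open>x$1, x$2, x$3\<close>; in it the line is \<open>x$3 = 0\<close>, and the
  residual cubic is the form \<open>g\<close> with \<open>F = x$3 * g\<close>. Polynomials over the complex numbers are
  identified with polynomial functions, so \<^const>\<open>deriv\<close> is the formal derivative.
\<close>

definition cubic_form :: "(complex^3 \<Rightarrow> complex) \<Rightarrow> bool" where
  "cubic_form g \<longleftrightarrow> (\<exists>c :: nat \<Rightarrow> nat \<Rightarrow> complex. \<forall>x.
     g x = (\<Sum>i\<le>3. \<Sum>j\<le>3 - i. c i j * (x$1)^i * (x$2)^j * (x$3)^(3 - i - j)))"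

definition residual_cubic ::
  "(complex^4 \<Rightarrow> complex) \<Rightarrow> complex^4 \<Rightarrow> complex^4 \<Rightarrow> complex^4 \<Rightarrow> (complex^3 \<Rightarrow> complex) \<Rightarrow> bool" where
  "residual_cubic F u v m g \<longleftrightarrow>
     cubic_form g \<and> (\<forall>x. F (x$1 *s u + x$2 *s v + x$3 *s m) = x$3 * g x)"

definition partial_deriv :: "3 \<Rightarrow> (complex^3 \<Rightarrow> complex) \<Rightarrow> complex^3 \<Rightarrow> complex" where
  "partial_deriv i g x = deriv (\<lambda>t. g (x + t *s axis i 1)) 0"

definition hessian :: "(complex^3 \<Rightarrow> complex) \<Rightarrow> complex^3 \<Rightarrow> complex" where
  "hessian g x = Determinants.det (\<chi> i j. partial_deriv i (partial_deriv j g) x)"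

definition poly_of_fun :: "(complex \<Rightarrow> complex) \<Rightarrow> complex poly" where
  "poly_of_fun f = (THE p. \<forall>t. poly p t = f t)"

text \<open>
  The resultant of two binary cubic forms is the \<open>6 \<times> 6\<close> Sylvester determinant of the
  dehomogenized forms, both taken with formal degree 3: this does not depend on their actual
  degrees, so common zeros at infinity are accounted for.
\<close>

definition cubic_resultant ::
  "(complex \<Rightarrow> complex \<Rightarrow> complex) \<Rightarrow> (complex \<Rightarrow> complex \<Rightarrow> complex) \<Rightarrow> complex" where
  "cubic_resultant f h =
     resultant_sub 3 3 (poly_of_fun (\<lambda>t. f t 1)) (poly_of_fun (\<lambda>t. h t 1))"

definition second_kind :: "(complex^4 \<Rightarrow> complex) \<Rightarrow> point set \<Rightarrow> bool" where
  "second_kind F l \<longleftrightarrow>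
     (\<forall>u v m g. l = projectivization (vec.span {u, v}) \<and> vec.dim (vec.span {u, v, m}) = 3 \<and>
        residual_cubic F u v m g \<longrightarrow>
        cubic_resultant (\<lambda>s t. g (vector [s, t, 0])) (\<lambda>s t. hessian g (vector [s, t, 0])) = 0)"

text \<open>
  A line on a smooth quartic that is not of the second kind is of the first kind. The 64 lines
  of the Schur quartic are 16 lines of the second kind (such as $x_0 = x_2 = 0$) and 48 of the
  first kind. For instance, the plane $x_3 = x_1$ through the line $x_2 = x_0, x_3 = x_1$ has
  residual cubic $t^3 - 4s^3 - 6s^2w - 4sw^2 - w^3$ with $s = x_0$, $t = x_1$, $w = x_2 - x_0$;
  on the line $w = 0$ it is $t^3 - 4s^3$, while its Hessian is $288 s^2 t$, and these two forms
  have no common zero.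
\<close>

definition first_kind :: "(complex^4 \<Rightarrow> complex) \<Rightarrow> point set \<Rightarrow> bool" where
  "first_kind F l \<longleftrightarrow> \<not> second_kind F l"


definition line_L :: "complex \<times> complex \<times> complex \<times> complex \<Rightarrow> point set" where
  "line_L = (\<lambda>(a, b, c, d).
     projectivization (vec.span {vector [1, 0, a, b], vector [0, 1, c, d]}))"

definition schur_params :: "complex \<Rightarrow> (complex \<times> complex \<times> complex \<times> complex) list" where
  "schur_params \<tau> =
    [(1, 0, 0, 1),
     (-1, 0, 0, -1),
     (-1, 0, 0, (1 - \<tau>)/2),
     (-1, 0, 0, (1 + \<tau>)/2),
     (1, 0, 0, -(1 + \<tau>)/2),
     (1, 0, 0, (-1 + \<tau>)/2),
     (-\<tau>/3, -1 - \<tau>/3, (-3 - \<tau>)/6, (3 - \<tau>)/6),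
     (-\<tau>/3, 2*\<tau>/3, (3 - \<tau>)/6, (3 - \<tau>)/6),
     (-\<tau>/3, 1 - \<tau>/3, \<tau>/3, (3 - \<tau>)/6),
     (\<tau>/3, -1 + \<tau>/3, (-3 + \<tau>)/6, (3 + \<tau>)/6),
     (\<tau>/3, -2*\<tau>/3, (3 + \<tau>)/6, (3 + \<tau>)/6),
     (\<tau>/3, 1 + \<tau>/3, -\<tau>/3, (3 + \<tau>)/6),
     (\<tau>/3, -1 + \<tau>/3, (3 + \<tau>)/6, -\<tau>/3),
     (\<tau>/3, -2*\<tau>/3, -\<tau>/3, -\<tau>/3),
     (\<tau>/3, 1 + \<tau>/3, (-3 + \<tau>)/6, -\<tau>/3),
     (-\<tau>/3, -1 - \<tau>/3, (3 - \<tau>)/6, \<tau>/3),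
     (-\<tau>/3, 2*\<tau>/3, \<tau>/3, \<tau>/3),
     (-\<tau>/3, 1 - \<tau>/3, (-3 - \<tau>)/6, \<tau>/3),
     (-\<tau>/3, -1 - \<tau>/3, \<tau>/3, (-3 - \<tau>)/6),
     (-\<tau>/3, 2*\<tau>/3, (-3 - \<tau>)/6, (-3 - \<tau>)/6),
     (-\<tau>/3, 1 - \<tau>/3, (3 - \<tau>)/6, (-3 - \<tau>)/6),
     (\<tau>/3, -1 + \<tau>/3, -\<tau>/3, (-3 + \<tau>)/6),
     (\<tau>/3, -2*\<tau>/3, (-3 + \<tau>)/6, (-3 + \<tau>)/6),
     (\<tau>/3, 1 + \<tau>/3, (3 + \<tau>)/6, (-3 + \<tau>)/6)]"


text \<open>
  An element of $PGL_4$ is represented by an invertible matrix; it acts on points by images of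
  subspaces. All divisors occurring here are effective sums of lines and are represented by
  multisets of lines, with \<^const>\<open>set_mset\<close> giving the components.
\<close>

type_synonym line_divisor = "point set multiset"

definition proj_map :: "complex^4^4 \<Rightarrow> point \<Rightarrow> point" where
  "proj_map A p = (*v) A ` p"

definition proj_automorphisms :: "(complex^4 \<Rightarrow> complex) \<Rightarrow> (point \<Rightarrow> point) set" where
  "proj_automorphisms F =
     {proj_map A | A. invertible A \<and> proj_map A ` zero_locus F = zero_locus F}"

definition push_divisor :: "(point \<Rightarrow> point) \<Rightarrow> line_divisor \<Rightarrow> line_divisor" where
  "push_divisor \<sigma> D = image_mset ((`) \<sigma>) D"

definition alpha :: "point \<Rightarrow> point" where
  "alpha = proj_map (\<chi> i j. if i = j then vector [1, 1, \<i>, \<i>] $ i else 0)"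

definition half :: "complex \<Rightarrow> line_divisor" where
  "half \<tau> = mset (map line_L (schur_params \<tau>))"


definition points_of_mult :: "line_divisor \<Rightarrow> nat \<Rightarrow> point set" where
  "points_of_mult D r = {p \<in> P3. card {l \<in> set_mset D. p \<in> l} = r}"

text \<open>Finiteness is stated because \<^const>\<open>card\<close> is 0 on infinite sets.\<close>

definition incidence_data :: "line_divisor \<Rightarrow> nat \<Rightarrow> nat \<Rightarrow> nat \<Rightarrow> nat \<Rightarrow> bool" where
  "incidence_data D n t2 t3 t4 \<longleftrightarrow>
     card (set_mset D) = n \<and>
     (\<forall>r\<in>{2, 3, 4}. finite (points_of_mult D r)) \<and>
     card (points_of_mult D 2) = t2 \<and>
     card (points_of_mult D 3) = t3 \<and>
     card (points_of_mult D 4) = t4"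

end

theory Submission
  imports Defs
begin

text \<open>
  With \<open>phi (s, t) = s^4 - s t^3\<close> the Schur quartic is the surface
  \<open>phi (x\<^sub>0, x\<^sub>1) = phi (x\<^sub>2, x\<^sub>3)\<close>. A line that is the graph of a matrix \<open>M\<close> lies on it exactly if
  \<open>M\<close> preserves \<open>phi\<close>. Solving for the coefficients shows that the group of these matrices has
  order 48 (\<open>symmetries_cases\<close>, \<open>symmetries_finite_card\<close>). A line that is not a graph joins a root
  of \<open>phi\<close> in the first coordinate plane to a root in the second one, which gives 16 further lines
  (\<open>lines_on_schur_cases\<close>).

  Pairs of symmetries of \<open>phi\<close> act on the surface and permute each of the two families
  transitively, and the kind of a line is invariant under this action
  (\<open>second_kind_transport\<close>). It is therefore enough to look at two lines. For $x_0 = x_2 = 0$ the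
  Hessian of every residual cubic vanishes on the line, so the 16 lines are of the second kind. For
  the graph of the identity a single plane shows that the 48 graph lines are of the first kind. So
  the configuration is the set of graph lines of the group (\<open>lines_of_first_kind\<close>).

  Incidences become group theory. The lines through the point \<open>(v : M v)\<close> are the graphs of the
  elements of the coset of \<open>M\<close> modulo the stabilizer of \<open>v\<close>, so the multiplicity of the point is
  the order of this stabilizer. A nontrivial stabilizer is generated by a complex reflection
  (\<open>reflections\<close>): four directions, the zeros of the Hessian of \<open>phi\<close>, have a stabilizer of order
  three, and six directions, the zeros of the sextic covariant, one of order two. Counting pairs of
  a line and a point on it gives $48 \cdot 4 / 3 = 64$ triple and $48 \cdot 6 / 2 = 144$ double
  points (\<open>card_points_of_mult\<close>).

  The cube of the determinant is a homomorphism from the group onto \<open>{1, - 1}\<close>. The 24 listed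
  lines belong to its kernel (\<open>set_schur_params\<close>), and \<open>alpha\<close> acts on graph lines as
  multiplication by the scalar matrix \<open>\<i>\<close>, whose determinant is \<open>- 1\<close>, so it exchanges the
  kernel with the other coset. The reflections of order three lie in the kernel and those of order two outside.
  Hence the three lines through a triple point belong to the same half and the two lines through a
  double point to different halves (\<open>lines_of_classes_through\<close>).
\<close>

section \<open>Coordinates, points and lines\<close>

lemma vector_4 [simp]:
  fixes x :: "'a::zero"
  shows "(vector [x, y, z, w] :: 'a^4) $ 1 = x" "(vector [x, y, z, w] :: 'a^4) $ 2 = y"
    "(vector [x, y, z, w] :: 'a^4) $ 3 = z" "(vector [x, y, z, w] :: 'a^4) $ 4 = w"
  unfolding vector_def by simp_all

text \<open>
  The equation of the surface separates the variables, so \<open>complex^4\<close> is treated throughout as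
  a sum of two planes: the first one carries $x_0, x_1$ and the second one $x_2, x_3$.
\<close>

definition join :: "complex^2 \<Rightarrow> complex^2 \<Rightarrow> complex^4" where
  "join v w = vector [v$1, v$2, w$1, w$2]"

definition upper :: "complex^4 \<Rightarrow> complex^2" where
  "upper x = vector [x$1, x$2]"

definition lower :: "complex^4 \<Rightarrow> complex^2" where
  "lower x = vector [x$3, x$4]"

lemma vec2_eq_iff: "v = w \<longleftrightarrow> v$1 = w$1 \<and> v$2 = w$2" for v w :: "'a^2"
  by (simp add: Finite_Cartesian_Product.vec_eq_iff forall_2)

lemma vec4_eq_iff: "x = y \<longleftrightarrow> x$1 = y$1 \<and> x$2 = y$2 \<and> x$3 = y$3 \<and> x$4 = y$4" for x y :: "'a^4"
  by (simp add: Finite_Cartesian_Product.vec_eq_iff forall_4)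

lemma join_components [simp]:
  "join v w $ 1 = v$1" "join v w $ 2 = v$2" "join v w $ 3 = w$1" "join v w $ 4 = w$2"
  by (simp_all add: join_def)

lemma upper_lower_components [simp]:
  "upper x $ 1 = x$1" "upper x $ 2 = x$2" "lower x $ 1 = x$3" "lower x $ 2 = x$4"
  by (simp_all add: upper_def lower_def)

lemma join_upper_lower [simp]:
  "upper (join v w) = v" "lower (join v w) = w" "join (upper x) (lower x) = x"
  by (simp_all add: vec2_eq_iff vec4_eq_iff)

lemma join_eq_iff [simp]: "join v w = join v' w' \<longleftrightarrow> v = v' \<and> w = w'"
  by (metis join_upper_lower(1,2))

lemma join_linear:
  "join v w + join v' w' = join (v + v') (w + w')" "k *s join v w = join (k *s v) (k *s w)"
  "join 0 0 = 0"
  by (simp_all add: vec4_eq_iff)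

lemma upper_lower_linear [simp]:
  "upper (x + y) = upper x + upper y" "lower (x + y) = lower x + lower y"
  "upper (k *s x) = k *s upper x" "lower (k *s x) = k *s lower x"
  "upper 0 = 0" "lower 0 = 0"
  by (simp_all add: vec2_eq_iff)

lemma join_eq_0_iff [simp]: "join v w = 0 \<longleftrightarrow> v = 0 \<and> w = 0"
  by (simp add: vec2_eq_iff vec4_eq_iff)

abbreviation id2 :: "complex^2^2" where
  "id2 \<equiv> Finite_Cartesian_Product.mat 1"

text \<open>
  The arguments are listed by columns, in the order in which the parameters
  $(a, b; c, d)$ of a line $L(a, b; c, d)$ are given.
\<close>

definition mat2 :: "complex \<Rightarrow> complex \<Rightarrow> complex \<Rightarrow> complex \<Rightarrow> complex^2^2" where
  "mat2 a b c d = vector [vector [a, c], vector [b, d]]"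

lemma mat2_components [simp]:
  "mat2 a b c d $ 1 $ 1 = a" "mat2 a b c d $ 1 $ 2 = c"
  "mat2 a b c d $ 2 $ 1 = b" "mat2 a b c d $ 2 $ 2 = d"
  by (simp_all add: mat2_def)

lemma mult_vec2_components [simp]:
  fixes M :: "complex^2^2"
  shows "(M *v v) $ 1 = M$1$1 * v$1 + M$1$2 * v$2" "(M *v v) $ 2 = M$2$1 * v$1 + M$2$2 * v$2"
  by (simp_all add: matrix_vector_mult_def sum_2)

lemma mat2_eq_iff:
  "M = mat2 a b c d \<longleftrightarrow> M$1$1 = a \<and> M$1$2 = c \<and> M$2$1 = b \<and> M$2$2 = d"
  by (auto simp: vec2_eq_iff)

lemma mat2_cases:
  obtains a b c d where "M = mat2 a b c d"
  by (simp add: mat2_eq_iff)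

lemma cramer_pair:
  fixes v w u :: "complex^2"
  defines "E \<equiv> v$1 * w$2 - v$2 * w$1"
  assumes "E \<noteq> 0"
  shows "((u$1 * w$2 - u$2 * w$1) / E) *s v + ((v$1 * u$2 - v$2 * u$1) / E) *s w = u"
  using \<open>E \<noteq> 0\<close> by (auto simp: vec2_eq_iff field_simps) (simp_all add: E_def algebra_simps)

lemma multiple_if_cross_zero:
  fixes v w :: "complex^2"
  assumes "v \<noteq> 0" "v$1 * w$2 - v$2 * w$1 = 0"
  obtains k where "w = k *s v"
proof (cases "v$1 = 0")
  case True
  then have "v$2 \<noteq> 0" using assms by (simp add: vec2_eq_iff)
  then have "w = (w$2 / v$2) *s v" using True assms by (simp add: vec2_eq_iff)
  then show thesis by (rule that)
next
  case False
  then have "w = (w$1 / v$1) *s v" using assms by (simp add: vec2_eq_iff field_simps)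
  then show thesis by (rule that)
qed

lemma det_mat2 [simp]: "Determinants.det (mat2 a b c d) = a * d - b * c"
  by (simp add: det_2)

lemma span_pair: "x \<in> vec.span {u, v} \<longleftrightarrow> (\<exists>k l. x = k *s u + l *s v)"
  for x u v :: "'a::field^'n"
  by (auto simp: vec.span_insert vec.span_singleton algebra_simps diff_eq_eq)

lemma span_single: "x \<in> vec.span {u} \<longleftrightarrow> (\<exists>k. x = k *s u)"
  for x u :: "'a::field^'n"
  by (auto simp: vec.span_singleton)

lemma span_eq_span_iff:
  fixes u x :: "'a::field^'n"
  assumes "x \<noteq> 0"
  shows "vec.span {x} = vec.span {u} \<longleftrightarrow> (\<exists>k. k \<noteq> 0 \<and> x = k *s u)"
proof
  assume "vec.span {x} = vec.span {u}"
  then have "x \<in> vec.span {u}" by (metis vec.span_base singletonI)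
  then obtain k where "x = k *s u" by (auto simp: span_single)
  with assms show "\<exists>k. k \<noteq> 0 \<and> x = k *s u" by (metis vector_smult_lzero)
next
  assume "\<exists>k. k \<noteq> 0 \<and> x = k *s u"
  then obtain k where k: "k \<noteq> 0" "x = k *s u" by blast
  then have u: "u = inverse k *s x" by (simp add: Finite_Cartesian_Product.vec_eq_iff)
  show "vec.span {x} = vec.span {u}"
  proof (rule Set.set_eqI)
    fix z show "z \<in> vec.span {x} \<longleftrightarrow> z \<in> vec.span {u}"
      unfolding span_single using k u by (metis vector_smult_assoc)
  qed
qed

lemma span_mem_projectivization_iff:
  assumes "vec.subspace W" "x \<noteq> 0"
  shows "vec.span {x} \<in> projectivization W \<longleftrightarrow> x \<in> W"
proof
  assume "vec.span {x} \<in> projectivization W"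
  then obtain v where v: "v \<in> W" "vec.span {x} = vec.span {v}"
    by (auto simp: projectivization_def)
  then obtain k where "x = k *s v" using span_eq_span_iff[OF assms(2)] by blast
  then show "x \<in> W" using v assms by (simp add: vec.subspace_scale)
qed (use assms in \<open>auto simp: projectivization_def\<close>)

lemma projectivization_eq_iff:
  assumes "vec.subspace W" "vec.subspace W'"
  shows "projectivization W = projectivization W' \<longleftrightarrow> W = W'"
proof
  assume eq: "projectivization W = projectivization W'"
  show "W = W'"
  proof (rule Set.set_eqI)
    fix x show "x \<in> W \<longleftrightarrow> x \<in> W'"
      using span_mem_projectivization_iff[OF assms(1), of x] eq
        span_mem_projectivization_iff[OF assms(2), of x] vec.subspace_0[OF assms(1)]
        vec.subspace_0[OF assms(2)] by (cases "x = 0") auto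
  qed
qed simp

definition graph :: "complex^2^2 \<Rightarrow> (complex^4) set" where
  "graph M = {x. lower x = M *v upper x}"

text \<open>
  Viewing a line as the graph of a matrix turns incidences into equations: the point of the
  vector \<open>join v w\<close> lies on the graph line of \<open>M\<close> exactly if \<open>M *v v = w\<close>.
\<close>

definition graph_line :: "complex^2^2 \<Rightarrow> point set" where
  "graph_line M = projectivization (graph M)"

lemma join_mem_graph [simp]: "join v w \<in> graph M \<longleftrightarrow> w = M *v v"
  by (simp add: graph_def)

lemma subspace_graph [simp]: "vec.subspace (graph M)"
  by (simp add: vec.subspace_def graph_def matrix_vector_right_distrib vector_scalar_commute)

lemma span_mem_graph_line [simp]:
  "x \<noteq> 0 \<Longrightarrow> vec.span {x} \<in> graph_line M \<longleftrightarrow> lower x = M *v upper x"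
  by (simp add: graph_line_def span_mem_projectivization_iff) (simp add: graph_def)

lemma graph_eq_span: "graph (mat2 a b c d) = vec.span {vector [1, 0, a, b], vector [0, 1, c, d]}"
proof (rule Set.set_eqI)
  fix x :: "complex^4"
  have "x \<in> graph (mat2 a b c d)
      \<longleftrightarrow> x = x$1 *s vector [1, 0, a, b] + x$2 *s vector [0, 1, c, d]"
    by (auto simp: graph_def vec2_eq_iff vec4_eq_iff algebra_simps)
  moreover have "x \<in> graph (mat2 a b c d)"
    if "x = k *s vector [1, 0, a, b] + l *s vector [0, 1, c, d]" for k l
    using that by (auto simp: graph_def vec2_eq_iff vec4_eq_iff algebra_simps)
  ultimately show "x \<in> graph (mat2 a b c d)
      \<longleftrightarrow> x \<in> vec.span {vector [1, 0, a, b], vector [0, 1, c, d]}"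
    unfolding span_pair by blast
qed

lemma line_L_eq_graph_line: "line_L (a, b, c, d) = graph_line (mat2 a b c d)"
  by (simp add: line_L_def graph_line_def graph_eq_span)

lemma graph_line_inject [simp]: "graph_line M = graph_line N \<longleftrightarrow> M = N"
proof
  assume "graph_line M = graph_line N"
  then have "graph M = graph N" by (simp add: graph_line_def projectivization_eq_iff)
  then have "M *v v = N *v v" for v using join_mem_graph[of v "M *v v" M] by simp
  then show "M = N" by (simp add: matrix_eq)
qed simp

lemma dim_pair:
  fixes u v :: "'a::field^'n"
  assumes "\<And>k l. k *s u + l *s v = 0 \<Longrightarrow> k = 0 \<and> l = 0"
  shows "vec.dim (vec.span {u, v}) = 2"
proof -
  have v: "v \<noteq> 0" using assms[of 0 1] by auto
  have u: "u \<notin> vec.span {v}"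
  proof
    assume "u \<in> vec.span {v}"
    then obtain k where "u = k *s v" by (auto simp: span_single)
    then have "1 *s u + (- k) *s v = 0" by (simp add: Finite_Cartesian_Product.vec_eq_iff)
    then show False using assms by fastforce
  qed
  have "vec.dim {u, v} = 2"
    using u v by (simp add: vec.dim_insert)
  then show ?thesis by simp
qed

lemma is_line_graph_line: "is_line (graph_line M)"
proof -
  obtain a b c d where M: "M = mat2 a b c d" by (rule mat2_cases)
  have "vec.dim (graph M) = 2" unfolding M graph_eq_span
    by (rule dim_pair) (auto simp: vec4_eq_iff)
  then show ?thesis unfolding is_line_def graph_line_def using subspace_graph by blast
qed

section \<open>The binary quartic and its symmetries\<close>

text \<open>
  The Schur quartic is \<open>phi (x\<^sub>0, x\<^sub>1) = phi (x\<^sub>2, x\<^sub>3)\<close>. The roots of this binary form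
  are one point and the three cube roots of unity, an equianharmonic quadruple, and this is why it
  has an unusually large symmetry group.
\<close>

definition phi :: "complex^2 \<Rightarrow> complex" where
  "phi v = (v$1)^4 - v$1 * (v$2)^3"

lemma schur_join: "schur (join v w) = phi v - phi w"
  by (simp add: schur_def phi_def)

lemma schur_eq_phi: "schur x = phi (upper x) - phi (lower x)"
  by (simp add: schur_def phi_def)

lemma phi_scale: "phi (k *s v) = k^4 * phi v"
  by (simp add: phi_def algebra_simps power4_eq_xxxx power3_eq_cube)

lemma schur_scale: "schur (k *s x) = k^4 * schur x"
  by (simp add: schur_eq_phi phi_scale algebra_simps)

lemma span_mem_zero_locus_iff:
  assumes "x \<noteq> 0"
  shows "vec.span {x} \<in> zero_locus schur \<longleftrightarrow> schur x = 0"
proof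
  assume "vec.span {x} \<in> zero_locus schur"
  then obtain v where "schur v = 0" "vec.span {x} = vec.span {v}"
    by (auto simp: zero_locus_def)
  then show "schur x = 0" using span_eq_span_iff[OF assms] by (auto simp: schur_scale)
qed (use assms in \<open>auto simp: zero_locus_def\<close>)

lemma projectivization_subset_zero_locus_iff:
  "projectivization W \<subseteq> zero_locus schur \<longleftrightarrow> (\<forall>x\<in>W. schur x = 0)"
proof
  assume L: "projectivization W \<subseteq> zero_locus schur"
  show "\<forall>x\<in>W. schur x = 0"
  proof
    fix x assume "x \<in> W"
    then show "schur x = 0"
      using L span_mem_zero_locus_iff[of x]
      by (cases "x = 0") (auto simp: projectivization_def schur_def)
  qed
qed (auto simp: projectivization_def zero_locus_def)

text \<open>
  Linear, not only projective, symmetries: a scalar matrix occurs only if its fourth power is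
  the identity. This is the complex reflection group of order 48 called $G_6$ by Shephard and
  Todd.
\<close>

definition symmetries :: "(complex^2^2) set" where
  "symmetries = {M. \<forall>v. phi (M *v v) = phi v}"

lemma graph_line_on_schur_iff: "graph_line M \<subseteq> zero_locus schur \<longleftrightarrow> M \<in> symmetries"
proof -
  have "graph_line M \<subseteq> zero_locus schur \<longleftrightarrow> (\<forall>x. lower x = M *v upper x \<longrightarrow> schur x = 0)"
    unfolding graph_line_def projectivization_subset_zero_locus_iff by (auto simp: graph_def)
  also have "\<dots> \<longleftrightarrow> (\<forall>v. schur (join v (M *v v)) = 0)"
    by (metis join_upper_lower)
  finally show ?thesis by (auto simp: symmetries_def schur_join)
qed

lemma quartic_coeffs_eq_0:
  fixes c0 c1 c2 c3 c4 :: complex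
  assumes "\<And>t. c0 + c1 * t + c2 * t^2 + c3 * t^3 + c4 * t^4 = 0"
  shows "c0 = 0 \<and> c1 = 0 \<and> c2 = 0 \<and> c3 = 0 \<and> c4 = 0"
proof -
  have "poly [:c0, c1, c2, c3, c4:] t = 0" for t
    using assms[of t] by (simp add: algebra_simps eval_nat_numeral)
  then have "[:c0, c1, c2, c3, c4:] = 0" using poly_all_0_iff_0 by blast
  then show ?thesis by simp
qed

text \<open>
  The five conditions compare the coefficients of $s^4, s^3t, s^2t^2, st^3, t^4$ in
  \<open>phi (M *v (s, t)) = phi (s, t)\<close>.
\<close>

lemma symmetries_mat2_iff:
  "mat2 a b c d \<in> symmetries \<longleftrightarrow>
     a^4 - a * b^3 = 1 \<and> 4 * a^3 * c - 3 * a * b^2 * d - c * b^3 = 0 \<and>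
     6 * a^2 * c^2 - 3 * a * b * d^2 - 3 * c * b^2 * d = 0 \<and>
     4 * a * c^3 - a * d^3 - 3 * c * b * d^2 = -1 \<and> c^4 - c * d^3 = 0"
  (is "_ \<longleftrightarrow> ?C")
proof
  assume M: "mat2 a b c d \<in> symmetries"
  have "(a^4 - a * b^3 - 1) + (4 * a^3 * c - 3 * a * b^2 * d - c * b^3) * t
     + (6 * a^2 * c^2 - 3 * a * b * d^2 - 3 * c * b^2 * d) * t^2
     + (4 * a * c^3 - a * d^3 - 3 * c * b * d^2 + 1) * t^3 + (c^4 - c * d^3) * t^4 = 0" for t
  proof -
    have "phi (mat2 a b c d *v vector [1, t]) = phi (vector [1, t])"
      using M by (simp add: symmetries_def)
    then show ?thesis by (simp add: phi_def) Groebner_Basis.algebra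
  qed
  from quartic_coeffs_eq_0[OF this] show ?C by (auto simp: eq_neg_iff_add_eq_0)
next
  assume C: ?C
  have "phi (mat2 a b c d *v v) = phi v" for v
    using C unfolding phi_def by simp Groebner_Basis.algebra
  then show "mat2 a b c d \<in> symmetries" by (simp add: symmetries_def)
qed

text \<open>
  The symmetries fixing the root \<open>(0 : 1)\<close> of \<open>phi\<close>.
\<close>

definition diagonal :: "complex \<Rightarrow> complex \<Rightarrow> complex^2^2" where
  "diagonal a \<zeta> = mat2 a 0 0 (a * \<zeta>)"

text \<open>
  The symmetries moving the root \<open>(0 : 1)\<close>; they send it to the root \<open>(1 : \<omega>)\<close>. The matrix is
  \<open>a\<close> times the product of \<open>diag (1, - \<omega>)\<close>, the integral matrix with rows \<open>(1, - 1)\<close> and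
  \<open>(2, 1)\<close>, and \<open>diag (1, \<zeta>)\<close>.
\<close>

definition mixing :: "complex \<Rightarrow> complex \<Rightarrow> complex \<Rightarrow> complex^2^2" where
  "mixing a \<omega> \<zeta> = mat2 a (- 2 * a * \<omega>) (- a * \<zeta>) (- a * \<omega> * \<zeta>)"

lemma diagonal_components [simp]:
  "diagonal a \<zeta> $ 1 $ 1 = a" "diagonal a \<zeta> $ 1 $ 2 = 0"
  "diagonal a \<zeta> $ 2 $ 1 = 0" "diagonal a \<zeta> $ 2 $ 2 = a * \<zeta>"
  by (simp_all add: diagonal_def)

lemma mixing_components [simp]:
  "mixing a \<omega> \<zeta> $ 1 $ 1 = a" "mixing a \<omega> \<zeta> $ 1 $ 2 = - a * \<zeta>"
  "mixing a \<omega> \<zeta> $ 2 $ 1 = - 2 * a * \<omega>" "mixing a \<omega> \<zeta> $ 2 $ 2 = - a * \<omega> * \<zeta>"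
  by (simp_all add: mixing_def)

lemma diagonal_symmetry:
  assumes "a^4 = 1" "\<zeta>^3 = 1"
  shows "diagonal a \<zeta> \<in> symmetries"
proof -
  have "a * (a * \<zeta>)^3 = a^4 * \<zeta>^3" by Groebner_Basis.algebra
  then show ?thesis using assms by (simp add: diagonal_def symmetries_mat2_iff)
qed

lemma mixing_symmetry:
  assumes "9 * a^4 = 1" "\<omega>^3 = 1" "\<zeta>^3 = 1"
  shows "mixing a \<omega> \<zeta> \<in> symmetries"
proof -
  define b c d where "b = - 2 * a * \<omega>" and "c = - a * \<zeta>" and "d = - a * \<omega> * \<zeta>"
  have 1: "a^4 - a * b^3 = 1" using assms unfolding b_def by Groebner_Basis.algebra
  have 2: "4 * a^3 * c - 3 * a * b^2 * d - c * b^3 = 0"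
    using assms unfolding b_def c_def d_def by Groebner_Basis.algebra
  have 3: "6 * a^2 * c^2 - 3 * a * b * d^2 - 3 * c * b^2 * d = 0"
    using assms unfolding b_def c_def d_def by Groebner_Basis.algebra
  have 4: "4 * a * c^3 - a * d^3 - 3 * c * b * d^2 = -1"
    using assms unfolding b_def c_def d_def by Groebner_Basis.algebra
  have 5: "c^4 - c * d^3 = 0"
    using assms unfolding c_def d_def by Groebner_Basis.algebra
  show ?thesis
    unfolding mixing_def symmetries_mat2_iff b_def[symmetric] c_def[symmetric] d_def[symmetric]
    using 1 2 3 4 5 by blast
qed

text \<open>
  The last column \<open>(c, d)\<close> of a symmetry is the image of a root, hence a root. If it is a multiple
  of \<open>(0, 1)\<close>, the matrix is diagonal. Otherwise \<open>d = \<omega> * c\<close> with \<open>\<omega>^3 = 1\<close>, the coefficient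
  of $s^2t^2$ factors and allows two values of \<open>b / a\<close>, one of which makes the coefficient of $s^4$
  vanish. What remains are equations for \<open>a^4\<close> and for \<open>(c / a)^3\<close>.
\<close>

lemma symmetries_cases:
  assumes "M \<in> symmetries"
  obtains (diagonal) a \<zeta> where "a^4 = 1" "\<zeta>^3 = 1" "M = diagonal a \<zeta>"
    | (mixing) a \<omega> \<zeta> where "9 * a^4 = 1" "\<omega>^3 = 1" "\<zeta>^3 = 1" "M = mixing a \<omega> \<zeta>"
proof -
  obtain a b c d where M: "M = mat2 a b c d" by (rule mat2_cases)
  have e: "a^4 - a * b^3 = 1" "4 * a^3 * c - 3 * a * b^2 * d - c * b^3 = 0"
     "6 * a^2 * c^2 - 3 * a * b * d^2 - 3 * c * b^2 * d = 0"
     "4 * a * c^3 - a * d^3 - 3 * c * b * d^2 = -1" "c^4 - c * d^3 = 0"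
    using assms unfolding M symmetries_mat2_iff by auto
  show thesis
  proof (cases "c = 0")
    case True
    then have "a \<noteq> 0" "d \<noteq> 0" "a * d^3 = 1" using e by auto
    moreover from this have "b = 0" using e(2) True by simp
    ultimately have "a^4 = 1" and "M = diagonal a (d / a)"
      using e(1) True by (auto simp: M diagonal_def)
    moreover have "d^3 = a^3"
      using \<open>a^4 = 1\<close> \<open>a * d^3 = 1\<close> by Groebner_Basis.algebra
    then have "(d / a)^3 = 1" using \<open>a \<noteq> 0\<close> by (simp add: power_divide)
    ultimately show thesis using that(1) by blast
  next
    case False
    define \<omega> where "\<omega> = d / c"
    have "c * (c^3 - d^3) = 0" using e(5) by Groebner_Basis.algebra
    then have "c^3 = d^3" using False by simp
    then have \<omega>: "\<omega>^3 = 1" using False by (simp add: \<omega>_def power_divide flip: \<open>c^3 = d^3\<close>)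
    have d: "d = \<omega> * c" using False by (simp add: \<omega>_def)
    \<comment> \<open>with this substitution \<open>\<omega>\<close> drops out of the remaining equations\<close>
    define B where "B = b * \<omega>^2"
    have b: "b = B * \<omega>" using \<omega> unfolding B_def by Groebner_Basis.algebra
    have "c^2 * ((2 * a + B) * (a - B)) = 0"
      using e(3) \<omega> unfolding b d by Groebner_Basis.algebra
    then have "B = - 2 * a \<or> B = a" using False by (auto simp: add_eq_0_iff)
    moreover have "B \<noteq> a" using e(1) \<omega> unfolding b by Groebner_Basis.algebra
    ultimately have B: "B = - 2 * a" by simp
    have a: "9 * a^4 = 1" using e(1) \<omega> unfolding b B by Groebner_Basis.algebra
    then have "a \<noteq> 0" by auto
    define \<zeta> where "\<zeta> = - c / a"
    have c: "c = - a * \<zeta>" using \<open>a \<noteq> 0\<close> by (simp add: \<zeta>_def)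
    have "9 * a^4 * \<zeta>^3 = 1" using e(4) \<omega> unfolding d b B c by Groebner_Basis.algebra
    then have "\<zeta>^3 = 1" using a by simp
    moreover have "M = mixing a \<omega> \<zeta>" by (simp add: M mixing_def d b B c mult_ac)
    ultimately show thesis using that(2) a \<omega> by blast
  qed
qed

section \<open>Classification of the lines on the Schur quartic\<close>

definition root_line :: "complex^2 \<Rightarrow> complex^2 \<Rightarrow> point set" where
  "root_line v w = projectivization (vec.span {join v 0, join 0 w})"

lemma subspace_eq_span_pair:
  fixes p :: "'a::field^'n"
  assumes W: "vec.subspace W" "vec.dim W = 2" and p: "p \<in> W" "p \<noteq> 0"
  obtains q where "q \<in> W" "q \<notin> vec.span {p}" "W = vec.span {p, q}"
proof -
  have "vec.dim (vec.span {p}) \<le> 1" by (simp add: vec.dim_insert)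
  then have "\<not> W \<subseteq> vec.span {p}"
    using vec.dim_subset[of W "vec.span {p}"] W(2) by linarith
  then obtain q where q: "q \<in> W" "q \<notin> vec.span {p}" by blast
  have "vec.span {p, q} = W"
  proof (rule vec.subspace_dim_equal)
    show "vec.span {p, q} \<subseteq> W" using W p q by (intro vec.span_minimal) auto
    have "vec.dim {q, p} = 2" using p q by (simp add: vec.dim_insert)
    then show "vec.dim W \<le> vec.dim (vec.span {p, q})" using W by (simp add: insert_commute)
  qed (use W in auto)
  then show thesis using that q by blast
qed

text \<open>
  A plane that meets the second coordinate plane only in 0 projects
  isomorphically to the first one, so it contains vectors over both unit vectors; their lower
  halves are the columns of the matrix.
\<close>

lemma transversal_plane_eq_graph:
  assumes W: "vec.subspace W" "vec.dim W = 2"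
    and inj: "\<And>x. x \<in> W \<Longrightarrow> upper x = 0 \<Longrightarrow> x = 0"
  obtains M where "W = graph M"
proof -
  have "\<exists>p\<in>W. p \<noteq> 0"
  proof (rule ccontr)
    assume "\<not> ?thesis"
    then have "W \<subseteq> {0}" by blast
    then show False using vec.dim_subset[of W "{0}"] W(2) by (simp add: vec.dim_insert)
  qed
  then obtain p where p: "p \<in> W" "p \<noteq> 0" by blast
  obtain q where q: "q \<in> W" "q \<notin> vec.span {p}"
    using subspace_eq_span_pair[OF W p] by blast
  have comb: "k *s p + l *s q \<in> W" for k l
    using W p q by (simp add: vec.subspace_add vec.subspace_scale)
  have indep: "k = 0 \<and> l = 0" if "upper (k *s p + l *s q) = 0" for k l
  proof -
    have eq: "k *s p + l *s q = 0" using inj comb that by blast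
    have "l = 0"
    proof (rule ccontr)
      assume "l \<noteq> 0"
      with eq have "q = (- k / l) *s p"
        by (simp add: Finite_Cartesian_Product.vec_eq_iff field_simps add_eq_0_iff)
      then show False using q by (metis span_single)
    qed
    with eq p show ?thesis by simp
  qed
  define D where "D = p$1 * q$2 - p$2 * q$1"
  have "D \<noteq> 0"
  proof
    assume D: "D = 0"
    have "upper (q$1 *s p + (- p$1) *s q) = 0" "upper (q$2 *s p + (- p$2) *s q) = 0"
      using D by (auto simp: D_def vec2_eq_iff algebra_simps)
    then have "p$1 = 0" "p$2 = 0" using indep by fastforce+
    then have "upper (1 *s p + 0 *s q) = 0" by (simp add: vec2_eq_iff)
    then show False using indep by fastforce
  qed
  define e1 e2 where "e1 = (q$2 / D) *s p + (- p$2 / D) *s q"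
    and "e2 = (- q$1 / D) *s p + (p$1 / D) *s q"
  have W12: "e1 \<in> W" "e2 \<in> W" unfolding e1_def e2_def by (rule comb)+
  have u: "e1$1 = 1" "e1$2 = 0" "e2$1 = 0" "e2$2 = 1"
    using \<open>D \<noteq> 0\<close> by (auto simp: e1_def e2_def field_simps) (simp_all add: D_def algebra_simps)
  define M where "M = mat2 (e1$3) (e1$4) (e2$3) (e2$4)"
  have graph: "x \<in> graph M \<longleftrightarrow> x = x$1 *s e1 + x$2 *s e2" for x
    using u by (auto simp: graph_def M_def vec2_eq_iff vec4_eq_iff algebra_simps)
  have "x \<in> graph M \<longleftrightarrow> x \<in> W" for x
  proof
    have c: "x$1 *s e1 + x$2 *s e2 \<in> W"
      using W W12 by (simp add: vec.subspace_add vec.subspace_scale)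
    then show "x \<in> graph M \<Longrightarrow> x \<in> W" unfolding graph by simp
    assume "x \<in> W"
    with c have "x - (x$1 *s e1 + x$2 *s e2) \<in> W" using W by (simp add: vec.subspace_diff)
    moreover have "upper (x - (x$1 *s e1 + x$2 *s e2)) = 0" by (simp add: vec2_eq_iff u)
    ultimately have "x - (x$1 *s e1 + x$2 *s e2) = 0" by (rule inj)
    then show "x \<in> graph M" unfolding graph by simp
  qed
  then show thesis using that by blast
qed

text \<open>
  Let \<open>join x z\<close> be a second basis vector. Along the plane, \<open>phi (k *s x)\<close> equals
  \<open>phi (t *s y + k *s z)\<close> and so does not depend on \<open>t\<close>. If \<open>y\<close> and \<open>z\<close> were independent, this
  would make \<open>phi\<close> a multiple of the fourth power of a linear form, which it is not. Hence \<open>z\<close>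
  can be cleared, and the plane is spanned by a vector in each coordinate plane.
\<close>

lemma nontransversal_plane_eq_join_of_roots:
  assumes W: "vec.subspace W" "vec.dim W = 2" and zero: "\<And>x. x \<in> W \<Longrightarrow> schur x = 0"
    and y: "join 0 y \<in> W" "y \<noteq> 0"
  obtains x where "x \<noteq> 0" "phi x = 0" "phi y = 0" "W = vec.span {join x 0, join 0 y}"
proof -
  have "join 0 y \<noteq> 0" using y by simp
  with W y obtain q where q: "q \<in> W" "q \<notin> vec.span {join 0 y}" "W = vec.span {join 0 y, q}"
    using subspace_eq_span_pair by metis
  define x z where "x = upper q" and "z = lower q"
  have q_eq: "q = join x z" by (simp add: x_def z_def)
  have phi_eq: "phi (k *s x) = phi (t *s y + k *s z)" for k t
  proof -
    have "t *s join 0 y + k *s q \<in> W" using W y q by (simp add: vec.subspace_add vec.subspace_scale)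
    from zero[OF this] show ?thesis by (simp add: q_eq join_linear schur_join)
  qed
  define E where "E = y$1 * z$2 - y$2 * z$1"
  have "E = 0"
  proof (rule ccontr)
    assume "E \<noteq> 0"
    have phi_power: "phi v = ((y$1 * v$2 - y$2 * v$1) / E)^4 * phi x" for v
    proof -
      have "((v$1 * z$2 - v$2 * z$1) / E) *s y + ((y$1 * v$2 - y$2 * v$1) / E) *s z = v"
        using cramer_pair[of y z v] \<open>E \<noteq> 0\<close> unfolding E_def by blast
      then show ?thesis using phi_eq by (metis phi_scale)
    qed
    \<comment> \<open>three values already contradict a pure fourth power: \<open>phi\<close> is 1, 0, 0 there\<close>
    show False
      using phi_power[of "vector [1, 0]"] phi_power[of "vector [0, 1]"]
        phi_power[of "vector [1, 1]"] \<open>E \<noteq> 0\<close>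
      by (auto simp: phi_def)
  qed
  obtain c where z: "z = c *s y"
    using multiple_if_cross_zero[OF y(2)] \<open>E = 0\<close> unfolding E_def by blast
  have W_eq: "W = vec.span {join x 0, join 0 y}"
  proof -
    have 1: "k *s join 0 y + l *s q = l *s join x 0 + (k + l * c) *s join 0 y" for k l
      by (simp add: q_eq z vec4_eq_iff algebra_simps)
    have 2: "k *s join x 0 + l *s join 0 y = (l - k * c) *s join 0 y + k *s q" for k l
      by (simp add: q_eq z vec4_eq_iff algebra_simps)
    show ?thesis
    proof (rule Set.set_eqI)
      fix w show "w \<in> W \<longleftrightarrow> w \<in> vec.span {join x 0, join 0 y}"
        unfolding q(3) span_pair using 1 2 by metis
    qed
  qed
  have "x \<noteq> 0"
  proof
    assume "x = 0"
    then have "q = c *s join 0 y" by (simp add: q_eq z join_linear)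
    then show False using q(2) by (metis span_single)
  qed
  moreover have "join x 0 \<in> W" unfolding W_eq by (simp add: vec.span_base)
  then have "phi x = 0" using zero[of "join x 0"] by (simp add: schur_join) (simp add: phi_def)
  moreover have "phi y = 0" using zero[OF y(1)] by (simp add: schur_join) (simp add: phi_def)
  ultimately show thesis using that W_eq by blast
qed

text \<open>
  There are $48 + 16$ lines: one for each symmetry of \<open>phi\<close> and one for each pair of roots.
\<close>

lemma lines_on_schur_cases:
  assumes "l \<in> lines_on schur"
  obtains (graph) M where "M \<in> symmetries" "l = graph_line M"
    | (roots) x y where "x \<noteq> 0" "y \<noteq> 0" "phi x = 0" "phi y = 0" "l = root_line x y"
proof -
  from assms obtain W where W: "vec.subspace W" "vec.dim W = 2" and l: "l = projectivization W"
    and on: "l \<subseteq> zero_locus schur"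
    by (auto simp: lines_on_def is_line_def)
  have zero: "schur x = 0" if "x \<in> W" for x
    using on that by (simp add: l projectivization_subset_zero_locus_iff)
  show thesis
  proof (cases "\<forall>x\<in>W. upper x = 0 \<longrightarrow> x = 0")
    case True
    then obtain M where "W = graph M" using transversal_plane_eq_graph[OF W] by blast
    then have "l = graph_line M" by (simp add: l graph_line_def)
    then show thesis using graph on by (simp add: graph_line_on_schur_iff)
  next
    case False
    then obtain p where p: "p \<in> W" "upper p = 0" "p \<noteq> 0" by blast
    then have "join 0 (lower p) \<in> W" "lower p \<noteq> 0"
      by (metis join_upper_lower(3) join_eq_0_iff)+
    from nontransversal_plane_eq_join_of_roots[OF W zero this] show thesis
      using roots \<open>lower p \<noteq> 0\<close> by (metis l root_line_def)
  qed
qed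

lemma graph_line_mem_lines_on: "M \<in> symmetries \<Longrightarrow> graph_line M \<in> lines_on schur"
  by (simp add: lines_on_def is_line_graph_line graph_line_on_schur_iff)

section \<open>The group of symmetries\<close>

lemma det_diagonal: "Determinants.det (diagonal a \<zeta>) = a^2 * \<zeta>"
  by (simp add: det_2 power2_eq_square)

lemma det_mixing: "Determinants.det (mixing a \<omega> \<zeta>) = - 3 * a^2 * \<omega> * \<zeta>"
  by (simp add: det_2 power2_eq_square)

lemma symmetry_invertible:
  assumes "M \<in> symmetries"
  shows "invertible M"
  using assms
proof (cases M rule: symmetries_cases)
  case (diagonal a \<zeta>)
  then show ?thesis by (auto simp: invertible_det_nz det_diagonal)
next
  case (mixing a \<omega> \<zeta>)
  then show ?thesis by (auto simp: invertible_det_nz det_mixing)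
qed

lemma symmetries_mult: "M \<in> symmetries \<Longrightarrow> N \<in> symmetries \<Longrightarrow> M ** N \<in> symmetries"
  by (simp add: symmetries_def flip: matrix_vector_mul_assoc)

lemma matrix_inv_vector:
  fixes A :: "complex^'n^'n"
  assumes "invertible A"
  shows "A *v (matrix_inv A *v v) = v" "matrix_inv A *v (A *v v) = v"
proof -
  have "A ** matrix_inv A = Finite_Cartesian_Product.mat 1 \<and>
      matrix_inv A ** A = Finite_Cartesian_Product.mat 1"
    unfolding matrix_inv_def using assms unfolding invertible_def by (rule someI_ex)
  then show "A *v (matrix_inv A *v v) = v" "matrix_inv A *v (A *v v) = v"
    by (simp_all add: matrix_vector_mul_assoc)
qed

lemma symmetries_matrix_inv:
  assumes "M \<in> symmetries"
  shows "matrix_inv M \<in> symmetries"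
proof -
  have "phi (matrix_inv M *v v) = phi v" for v
    using assms matrix_inv_vector(1)[OF symmetry_invertible[OF assms], of v]
    by (metis (mono_tags, lifting) mem_Collect_eq symmetries_def)
  then show ?thesis by (simp add: symmetries_def)
qed

lemma one_symmetry: "id2 \<in> symmetries"
  by (simp add: symmetries_def)

section \<open>Projective symmetries and the kind of a line\<close>

lemma linear_mult_matrix: "A *v (k *s x + l *s y) = k *s (A *v x) + l *s (A *v y)"
  for A :: "complex^'n^'m"
  by (simp add: matrix_vector_right_distrib vector_scalar_commute)

lemma proj_map_span: "proj_map A (vec.span S) = vec.span ((*v) A ` S)"
  by (simp add: proj_map_def vec.linear_span_image)

lemma proj_map_projectivization:
  assumes "invertible A"
  shows "proj_map A ` projectivization W = projectivization ((*v) A ` W)"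
proof -
  have "A *v x = 0 \<longleftrightarrow> x = 0" for x
    using matrix_inv_vector(2)[OF assms] by (metis matrix_vector_mult_0_right)
  then show ?thesis
    by (auto simp: projectivization_def proj_map_span setcompr_eq_image image_image)
qed

lemma invertible_matrix_inv: "invertible A \<Longrightarrow> invertible (matrix_inv A)"
  for A :: "complex^'n^'n"
  unfolding invertible_def
  by (metis (no_types) matrix_eq matrix_inv_vector matrix_vector_mul_assoc matrix_vector_mul_lid
      invertible_def)

text \<open>
  A linear automorphism carries a plane through a line, together with a chosen basis, to
  a plane through the image of the line, and the residual cubic is literally the same form in
  these bases. So no transformation rule for Hessians is needed.
\<close>

lemma second_kind_transport:
  assumes A: "invertible A" and F: "\<And>x. F (A *v x) = F x" and l: "second_kind F l"
  shows "second_kind F (proj_map A ` l)"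
  unfolding second_kind_def
proof (intro allI impI, elim conjE)
  fix u v m g
  assume eq: "proj_map A ` l = projectivization (vec.span {u, v})"
    and dim: "vec.dim (vec.span {u, v, m}) = 3" and g: "residual_cubic F u v m g"
  define B where "B = matrix_inv A"
  have B: "invertible B" using A by (simp add: B_def invertible_matrix_inv)
  have AB: "A *v (B *v x) = x" "B *v (A *v x) = x" for x
    using matrix_inv_vector[OF A] by (simp_all add: B_def)
  have FB: "F (B *v x) = F x" for x by (metis AB(1) F)
  have inj: "inj ((*v) B)" by (metis AB(1) injI)
  have "proj_map B (proj_map A p) = p" for p
    by (simp add: proj_map_def image_image AB)
  then have "l = proj_map B ` proj_map A ` l" by (simp add: image_image)
  then have l': "l = projectivization (vec.span {B *v u, B *v v})"
    using B by (simp add: eq proj_map_projectivization flip: proj_map_span)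
      (simp add: proj_map_span flip: proj_map_def)
  have dim': "vec.dim (vec.span {B *v u, B *v v, B *v m}) = 3"
  proof -
    have "vec.dim ((*v) B ` {u, v, m}) = vec.dim {u, v, m}"
      by (rule vec.dim_image_eq) (use inj in \<open>auto intro: inj_on_subset\<close>)
    then show ?thesis using dim by simp
  qed
  have "residual_cubic F (B *v u) (B *v v) (B *v m) g"
    using g FB unfolding residual_cubic_def
    by (metis (no_types, lifting) matrix_vector_right_distrib vector_scalar_commute)
  with l l' dim' show "cubic_resultant (\<lambda>s t. g (vector [s, t, 0]))
      (\<lambda>s t. hessian g (vector [s, t, 0])) = 0"
    unfolding second_kind_def by blast
qed

text \<open>
  Symmetries of \<open>phi\<close> acting separately on the two coordinate planes preserve the surface.
  This group is transitive on the graph lines and on the lines joining two roots, so the kind of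
  one line of each type decides the kind of all.
\<close>

definition block :: "complex^2^2 \<Rightarrow> complex^2^2 \<Rightarrow> complex^4^4" where
  "block M N = vector [join (M$1) 0, join (M$2) 0, join 0 (N$1), join 0 (N$2)]"

lemma block_mult: "block M N *v x = join (M *v upper x) (N *v lower x)"
  by (simp add: vec4_eq_iff matrix_vector_mult_def sum_4 sum_2 block_def)

lemma invertible_block:
  assumes "invertible M" "invertible N"
  shows "invertible (block M N)"
proof -
  have "block (matrix_inv M) (matrix_inv N) ** block M N = Finite_Cartesian_Product.mat 1"
    using assms by (simp add: matrix_eq block_mult matrix_inv_vector flip: matrix_vector_mul_assoc)
  then show ?thesis by (auto simp: invertible_left_inverse)
qed

lemma schur_block:
  "M \<in> symmetries \<Longrightarrow> N \<in> symmetries \<Longrightarrow> schur (block M N *v x) = schur x"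
  by (simp add: block_mult schur_eq_phi symmetries_def)

lemma block_graph_line:
  assumes "invertible M" "invertible N"
  shows "proj_map (block M N) ` graph_line P = graph_line (N ** P ** matrix_inv M)"
proof -
  have "x \<in> (*v) (block M N) ` graph P \<longleftrightarrow> x \<in> graph (N ** P ** matrix_inv M)" for x
  proof
    assume x: "x \<in> graph (N ** P ** matrix_inv M)"
    define v where "v = matrix_inv M *v upper x"
    have "upper x = M *v v" "lower x = N *v (P *v v)"
      using x assms by (simp_all add: v_def graph_def matrix_inv_vector flip: matrix_vector_mul_assoc)
    then have "x = block M N *v join v (P *v v)"
      by (metis block_mult join_upper_lower)
    then show "x \<in> (*v) (block M N) ` graph P" by (metis imageI join_mem_graph)
  qed (use assms in \<open>auto simp: graph_def block_mult matrix_inv_vector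
      simp flip: matrix_vector_mul_assoc\<close>)
  then show ?thesis
    unfolding graph_line_def proj_map_projectivization[OF invertible_block[OF assms]]
    by (metis Set.set_eqI)
qed

lemma block_root_line:
  assumes "invertible M" "invertible N"
  shows "proj_map (block M N) ` root_line v w = root_line (M *v v) (N *v w)"
  using invertible_block[OF assms]
  by (simp add: root_line_def proj_map_projectivization flip: proj_map_def)
     (simp add: proj_map_span block_mult)

section \<open>Resultants and Hessians\<close>

lemma poly_of_fun_eqI:
  assumes "\<And>t. poly p t = f t"
  shows "poly_of_fun f = p"
  unfolding poly_of_fun_def
proof (rule the_equality)
  fix q assume "\<forall>t. poly q t = f t"
  with assms show "q = p" by (intro poly_eqI_degree_lead_coeff poly_ext) simp
qed (use assms in simp)

lemma resultant_sub_zero_right: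
  fixes p :: "complex poly"
  shows "resultant_sub 3 3 p 0 = 0"
proof -
  have "row (sylvester_mat_sub 3 3 p 0) 3 = row (sylvester_mat_sub 3 3 p 0) 4"
    by (rule eq_vecI) (auto simp: sylvester_mat_sub_index)
  then show ?thesis
    unfolding resultant_sub_def
    by (intro det_identical_rows[OF sylvester_mat_sub_carrier, of 3 4]) auto
qed

text \<open>
  The forms $a t^3 + b s^3$ and $c s^2 t$ have no common zero. The Sylvester
  matrix is sparse enough to read off from its rows that its kernel is trivial.
\<close>

lemma resultant_sub_pure_powers_nonzero:
  fixes a b c :: complex
  assumes "a \<noteq> 0" "b \<noteq> 0" "c \<noteq> 0"
  shows "resultant_sub 3 3 [:a, 0, 0, b:] [:0, 0, c:] \<noteq> 0"
proof
  let ?S = "sylvester_mat_sub 3 3 [:a, 0, 0, b:] [:0, 0, c:]"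
  assume "resultant_sub 3 3 [:a, 0, 0, b:] [:0, 0, c:] = 0"
  then obtain w where w: "w \<in> carrier_vec 6" "w \<noteq> 0\<^sub>v 6" and Sw: "?S *\<^sub>v w = 0\<^sub>v 6"
    using det_0_iff_vec_prod_zero[OF sylvester_mat_sub_carrier, of 3 3 "[:a, 0, 0, b:]" "[:0, 0, c:]"]
    by (auto simp: resultant_sub_def)
  have "(\<Sum>j = 0..<6. ?S $$ (i, j) * vec_index w j) = 0" if "i < 6" for i
    using arg_cong[OF Sw, of "\<lambda>v. vec_index v i"] that w
    by (simp add: scalar_prod_def)
  then have rows: "\<forall>i\<in>{0..<6}. (\<Sum>j = 0..<6. ?S $$ (i, j) * vec_index w j) = 0" by simp
  have "vec_index w j = 0" if "j < 6" for j
  proof -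
    have "\<forall>j\<in>{0..<6}. vec_index w j = 0"
      using rows assms
      by (auto simp: sylvester_mat_sub_index eval_nat_numeral atLeast0_lessThan_Suc)
    with that show ?thesis by simp
  qed
  with w show False by (auto intro!: eq_vecI)
qed

definition dot :: "complex^3 \<Rightarrow> complex^3 \<Rightarrow> complex" where
  "dot l x = l$1 * x$1 + l$2 * x$2 + l$3 * x$3"

text \<open>
  Both residual cubics that have to be computed are sums of cubes of few linear forms. In this
  presentation differentiation only changes the exponent and the coefficients.
\<close>

definition power_sum :: "nat \<Rightarrow> (complex \<times> (complex^3)) list \<Rightarrow> complex^3 \<Rightarrow> complex" where
  "power_sum n ps x = (\<Sum>(c, l)\<leftarrow>ps. c * dot l x ^ n)"

lemma power_sum_simps [simp]:
  "power_sum n [] x = 0"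
  "power_sum n ((c, l) # ps) x = c * dot l x ^ n + power_sum n ps x"
  by (simp_all add: power_sum_def)

lemma cubic_form_power_sum: "cubic_form (power_sum 3 ps)"
proof (induction ps)
  case Nil
  show ?case unfolding cubic_form_def by (rule exI[of _ "\<lambda>i j. 0"]) simp
next
  case (Cons p ps)
  obtain c l where p: "p = (c, l)" by (cases p)
  define b where "b i j = c * fact 3 / (fact i * fact j * fact (3 - i - j))
      * l$1 ^ i * l$2 ^ j * l$3 ^ (3 - i - j)" for i j :: nat
  \<comment> \<open>the multinomial theorem\<close>
  have cube: "c * dot l x ^ 3
      = (\<Sum>i\<le>3. \<Sum>j\<le>3 - i. b i j * (x$1)^i * (x$2)^j * (x$3)^(3 - i - j))" for x
    by (simp add: b_def dot_def eval_nat_numeral algebra_simps)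
  obtain d where d: "\<And>x. power_sum 3 ps x
      = (\<Sum>i\<le>3. \<Sum>j\<le>3 - i. d i j * (x$1)^i * (x$2)^j * (x$3)^(3 - i - j))"
    using Cons.IH unfolding cubic_form_def by blast
  show ?case
    unfolding cubic_form_def p power_sum_simps cube d
    by (rule exI[of _ "\<lambda>i j. b i j + d i j"]) (simp add: sum.distrib algebra_simps)
qed

lemma partial_deriv_power_sum:
  "partial_deriv i (power_sum n ps)
     = power_sum (n - 1) (map (\<lambda>(c, l). (of_nat n * c * l$i, l)) ps)"
proof
  fix x
  have dot: "dot l (x + t *s axis i 1) = dot l x + t * l$i" for l t
    using exhaust_3[of i] by (auto simp: dot_def axis_def algebra_simps)
  have "((\<lambda>t. power_sum n ps (x + t *s axis i 1)) has_field_derivative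
      power_sum (n - 1) (map (\<lambda>(c, l). (of_nat n * c * l$i, l)) ps) x) (at 0)"
  proof (induction ps)
    case (Cons p ps)
    obtain c l where p: "p = (c, l)" by (cases p)
    show ?case unfolding p power_sum_simps list.map prod.case dot
      by (rule derivative_eq_intros Cons.IH refl)+ simp
  qed simp
  then show "partial_deriv i (power_sum n ps) x
      = power_sum (n - 1) (map (\<lambda>(c, l). (of_nat n * c * l$i, l)) ps) x"
    unfolding partial_deriv_def by (rule DERIV_imp_deriv)
qed

text \<open>
  Up to the factor 6, the matrix of second derivatives is the sum of the rank one matrices
  $l\,l^T$, weighted by the values of the linear forms. In particular the Hessian vanishes
  wherever all but two of the linear forms vanish.
\<close>

lemma hessian_power_sum:
  "hessian (power_sum 3 ps) x
     = Determinants.det (\<chi> i j. 6 * power_sum 1 (map (\<lambda>(c, l). (c * l$i * l$j, l)) ps) x)"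
proof -
  have "power_sum 1 (map (\<lambda>(c, l). (of_nat 2 * (of_nat 3 * c * l$j) * l$i, l)) ps) x
      = 6 * power_sum 1 (map (\<lambda>(c, l). (c * l$i * l$j, l)) ps) x" for i j
    by (induction ps) (auto simp: algebra_simps)
  then show ?thesis
    by (simp add: hessian_def partial_deriv_power_sum comp_def case_prod_unfold)
qed

lemma cubic_form_continuous:
  assumes "cubic_form g"
  shows "continuous_on UNIV (\<lambda>t. g (x + t *s axis 3 1))"
proof -
  obtain c where "\<And>x. g x = (\<Sum>i\<le>3. \<Sum>j\<le>3 - i. c i j * (x$1)^i * (x$2)^j * (x$3)^(3 - i - j))"
    using assms unfolding cubic_form_def by blast
  then have "g (x + t *s axis 3 1)
      = (\<Sum>i\<le>3. \<Sum>j\<le>3 - i. c i j * (x$1)^i * (x$2)^j * (x$3 + t)^(3 - i - j))" for t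
    by (simp add: axis_def)
  then show ?thesis by (simp only:) (intro continuous_intros)
qed

text \<open>
  The equation for the residual cubic determines it only off the line \<open>x$3 = 0\<close>;
  continuity gives the values on the line, which are the ones that matter.
\<close>

lemma cubic_form_cancel:
  assumes "cubic_form g" "cubic_form h" and eq: "\<And>x. x$3 * g x = x$3 * h x"
  shows "g = h"
proof
  fix x
  define f where "f t = g (x + t *s axis 3 1) - h (x + t *s axis 3 1)" for t
  have "continuous_on UNIV f" unfolding f_def
    using assms(1,2)[THEN cubic_form_continuous] by (rule continuous_on_diff)
  then have "(f \<longlongrightarrow> f (- x$3)) (at (- x$3))"
    by (simp add: continuous_on_eq_continuous_at isCont_def)
  moreover have off: "f t = 0" if "t \<noteq> - x$3" for t
    using eq[of "x + t *s axis 3 1"] that by (auto simp: f_def axis_def add_eq_0_iff)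
  then have "(f \<longlongrightarrow> 0) (at (- x$3))"
    by (intro tendsto_eventually) (auto simp: eventually_at_filter)
  ultimately have f0: "f (- x$3) = 0" by (rule LIM_unique)
  have "f 0 = 0" using f0 off[of 0] by (cases "x$3 = 0") auto
  then show "g x = h x" by (simp add: f_def)
qed

section \<open>Lines of the first and of the second kind\<close>

text \<open>
  For every plane through the line $x_0 = x_2 = 0$ the residual cubic is a sum of three cubes
  of linear forms, one of which is the equation of the line in the plane. On the line only two
  rank one terms of the Hessian matrix survive, so the Hessian vanishes identically there.
\<close>

lemma second_kind_coordinate_line:
  "second_kind schur (root_line (vector [0, 1]) (vector [0, 1]))"
  unfolding second_kind_def
proof (intro allI impI, elim conjE)
  fix u v m g
  assume "root_line (vector [0, 1]) (vector [0, 1]) = projectivization (vec.span {u, v})"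
    and g: "residual_cubic schur u v m g"
  then have "vec.span {join (vector [0, 1]) 0, join 0 (vector [0, 1])} = vec.span {u, v}"
    by (simp add: root_line_def projectivization_eq_iff)
  then have "u \<in> vec.span {join (vector [0, 1]) 0, join 0 (vector [0, 1])}"
    "v \<in> vec.span {join (vector [0, 1]) 0, join 0 (vector [0, 1])}"
    by (simp_all add: vec.span_base)
  then have uv: "u$1 = 0" "u$3 = 0" "v$1 = 0" "v$3 = 0"
    unfolding span_pair by auto
  \<comment> \<open>coordinates on the plane: the restrictions of $x_1$ and $x_3$, and the equation of the line\<close>
  define h where "h = power_sum 3
    [(- m$1, vector [u$2, v$2, m$2]), (m$3, vector [u$4, v$4, m$4]),
     ((m$1)^4 - (m$3)^4, vector [0, 0, 1])]"
  have "x$3 * g x = x$3 * h x" for x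
  proof -
    have "x$3 * g x = schur (x$1 *s u + x$2 *s v + x$3 *s m)"
      using g by (simp add: residual_cubic_def)
    also have "\<dots> = x$3 * h x"
      by (simp add: schur_def uv h_def dot_def) Groebner_Basis.algebra
    finally show ?thesis .
  qed
  then have gh: "g = h"
    using g by (intro cubic_form_cancel) (auto simp: residual_cubic_def h_def cubic_form_power_sum)
  have "hessian g (vector [s, t, 0]) = 0" for s t
    unfolding gh h_def hessian_power_sum by (simp add: det_3 dot_def) Groebner_Basis.algebra
  then have "poly_of_fun (\<lambda>s. hessian g (vector [s, 1, 0])) = 0"
    by (intro poly_of_fun_eqI) simp
  then show "cubic_resultant (\<lambda>s t. g (vector [s, t, 0]))
      (\<lambda>s t. hessian g (vector [s, t, 0])) = 0"
    by (simp add: cubic_resultant_def resultant_sub_zero_right)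
qed

text \<open>
  One plane suffices. In the plane $x_1 = x_3$ the residual cubic restricts to $t^3 - 4s^3$
  on the line, and its Hessian to $288 s^2 t$.
\<close>

lemma first_kind_identity_line: "first_kind schur (graph_line (mat2 1 0 0 1))"
proof -
  define u v m :: "complex^4"
    where "u = vector [1, 0, 1, 0]" and "v = vector [0, 1, 0, 1]" and "m = vector [0, 0, 1, 0]"
  \<comment> \<open>the cubic \<open>t^3 - 4 s^3 - 6 s^2 w - 4 s w^2 - w^3\<close> written as a sum of cubes\<close>
  define g where "g = power_sum 3
    [(1, vector [0, 1, 0]), (- 1/3, vector [2, 0, 1]), (- 2/3, vector [1, 0, 1]),
     (- 2/3, vector [1, 0, 0])]"
  have line: "graph_line (mat2 1 0 0 1) = projectivization (vec.span {u, v})"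
    by (simp add: graph_line_def graph_eq_span u_def v_def)
  have "u \<notin> vec.span {v, m}" "v \<notin> vec.span {m}" "m \<noteq> 0"
    by (auto simp: span_pair span_single u_def v_def m_def vec4_eq_iff)
  then have dim: "vec.dim (vec.span {u, v, m}) = 3" by (simp add: vec.dim_insert)
  have "schur (x$1 *s u + x$2 *s v + x$3 *s m) = x$3 * g x" for x
    by (simp add: schur_def u_def v_def m_def g_def dot_def field_simps) Groebner_Basis.algebra
  then have residual: "residual_cubic schur u v m g"
    by (simp add: residual_cubic_def g_def cubic_form_power_sum)
  have "poly_of_fun (\<lambda>s. g (vector [s, 1, 0])) = [:1, 0, 0, -4:]"
    by (rule poly_of_fun_eqI) (simp add: g_def dot_def eval_nat_numeral)
  moreover have "hessian g (vector [s, t, 0]) = 288 * s^2 * t" for s t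
    unfolding g_def hessian_power_sum by (simp add: det_3 dot_def) Groebner_Basis.algebra
  then have "poly_of_fun (\<lambda>s. hessian g (vector [s, 1, 0])) = [:0, 0, 288:]"
    by (intro poly_of_fun_eqI) (simp add: power2_eq_square)
  ultimately have "cubic_resultant (\<lambda>s t. g (vector [s, t, 0]))
      (\<lambda>s t. hessian g (vector [s, t, 0])) \<noteq> 0"
    using resultant_sub_pure_powers_nonzero[of 1 "-4" 288] by (simp add: cubic_resultant_def)
  then show ?thesis
    unfolding first_kind_def second_kind_def using line dim residual by blast
qed

lemma first_kind_graph_line:
  assumes "M \<in> symmetries"
  shows "first_kind schur (graph_line M)"
proof (rule ccontr)
  let ?N = "matrix_inv M"
  assume "\<not> first_kind schur (graph_line M)"
  then have M: "second_kind schur (graph_line M)" by (simp add: first_kind_def)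
  have N: "?N \<in> symmetries" using assms by (rule symmetries_matrix_inv)
  have I: "invertible id2" by (auto simp: invertible_def)
  have "second_kind schur (proj_map (block id2 ?N) ` graph_line M)"
    using M N by (intro second_kind_transport invertible_block I symmetry_invertible schur_block
        one_symmetry)
  moreover have "?N ** M ** matrix_inv id2 = mat2 1 0 0 1"
  proof -
    have "(?N ** M ** matrix_inv id2) *v v = v" for v
      using matrix_inv_vector(1)[OF I, of v] matrix_inv_vector(2)[OF symmetry_invertible[OF assms]]
      by (simp flip: matrix_vector_mul_assoc)
    then show ?thesis by (simp add: matrix_eq vec2_eq_iff)
  qed
  ultimately show False
    using first_kind_identity_line
    by (simp add: block_graph_line I symmetry_invertible[OF N] first_kind_def)
qed

text \<open>
  The symmetries permute the roots of \<open>phi\<close> transitively.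
\<close>

lemma root_eq_image_of_axis:
  assumes "x \<noteq> 0" "phi x = 0"
  obtains N k where "N \<in> symmetries" "k \<noteq> 0" "x = k *s (N *v vector [0, 1])"
proof (cases "x$1 = 0")
  case True
  then have "x$2 \<noteq> 0" using assms by (simp add: vec2_eq_iff)
  moreover have "x = x$2 *s (id2 *v vector [0, 1])"
    using True by (simp add: vec2_eq_iff)
  ultimately show thesis using that one_symmetry by blast
next
  case False
  define a \<omega> where "a = csqrt (1/3)" and "\<omega> = x$2 / x$1"
  have a2: "a^2 = 1/3" unfolding a_def by (rule power2_csqrt)
  then have "3 * a^2 = 1" by (simp add: mult.commute)
  then have a: "9 * a^4 = 1" by Groebner_Basis.algebra
  then have "a \<noteq> 0" by auto
  have "x$1 * ((x$1)^3 - (x$2)^3) = 0" using assms(2) unfolding phi_def by Groebner_Basis.algebra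
  then have "(x$2)^3 = (x$1)^3" using False by simp
  then have "\<omega>^3 = 1" using False by (simp add: \<omega>_def power_divide)
  with a have "mixing a \<omega> 1 \<in> symmetries" by (intro mixing_symmetry) auto
  moreover have "x = (- x$1 / a) *s (mixing a \<omega> 1 *v vector [0, 1])"
    using False \<open>a \<noteq> 0\<close> by (simp add: vec2_eq_iff \<omega>_def)
  moreover have "- x$1 / a \<noteq> 0" using False \<open>a \<noteq> 0\<close> by simp
  ultimately show thesis using that by blast
qed

lemma root_line_scale:
  assumes "k \<noteq> 0" "l \<noteq> 0"
  shows "root_line (k *s v) (l *s w) = root_line v w"
proof -
  have "i *s join (k *s v) 0 + j *s join 0 (l *s w) = (i * k) *s join v 0 + (j * l) *s join 0 w"
    "i *s join v 0 + j *s join 0 w = (i / k) *s join (k *s v) 0 + (j / l) *s join 0 (l *s w)" for i j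
    using assms by (simp_all add: vec4_eq_iff)
  then have "x \<in> vec.span {join (k *s v) 0, join 0 (l *s w)} \<longleftrightarrow> x \<in> vec.span {join v 0, join 0 w}"
    for x unfolding span_pair by metis
  then show ?thesis unfolding root_line_def by (metis Set.set_eqI)
qed

lemma second_kind_root_line:
  assumes "x \<noteq> 0" "phi x = 0" "y \<noteq> 0" "phi y = 0"
  shows "second_kind schur (root_line x y)"
proof -
  obtain M k where M: "M \<in> symmetries" "k \<noteq> 0" "x = k *s (M *v vector [0, 1])"
    using root_eq_image_of_axis assms(1,2) by blast
  obtain N l where N: "N \<in> symmetries" "l \<noteq> 0" "y = l *s (N *v vector [0, 1])"
    using root_eq_image_of_axis assms(3,4) by blast
  have "second_kind schur (proj_map (block M N) ` root_line (vector [0, 1]) (vector [0, 1]))"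
    using M N second_kind_coordinate_line
    by (intro second_kind_transport invertible_block symmetry_invertible schur_block)
  then show ?thesis
    using M N by (simp add: block_root_line symmetry_invertible root_line_scale)
qed

lemma lines_of_first_kind:
  "{l \<in> lines_on schur. first_kind schur l} = graph_line ` symmetries"
proof (intro Set.set_eqI iffI)
  fix l assume "l \<in> {l \<in> lines_on schur. first_kind schur l}"
  then have l: "l \<in> lines_on schur" "first_kind schur l" by auto
  from l(1) show "l \<in> graph_line ` symmetries"
  proof (cases rule: lines_on_schur_cases)
    case (roots x y)
    then show ?thesis using l(2) second_kind_root_line by (simp add: first_kind_def)
  qed simp
qed (auto simp: graph_line_mem_lines_on first_kind_graph_line)

section \<open>Points on the graph lines of a group\<close>

text \<open>
  All lines through a point \<open>(v : M *v v)\<close> come from the coset \<open>M ** fixing S v\<close>. The multiplicity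
  of the point is therefore the order of a stabilizer and does not depend on \<open>M\<close>.
\<close>

definition fixing :: "(complex^2^2) set \<Rightarrow> complex^2 \<Rightarrow> (complex^2^2) set" where
  "fixing S v = {M \<in> S. M *v v = v}"

definition matrix_group :: "(complex^2^2) set \<Rightarrow> bool" where
  "matrix_group S \<longleftrightarrow> S \<subseteq> symmetries \<and> id2 \<in> S \<and> (\<forall>M\<in>S. \<forall>N\<in>S. M ** N \<in> S) \<and>
     (\<forall>M\<in>S. matrix_inv M \<in> S)"

lemma matrix_inv_mult:
  assumes "M \<in> symmetries"
  shows "matrix_inv M ** (M ** N) = N" "M ** (matrix_inv M ** N) = N"
  using matrix_inv_vector[OF symmetry_invertible[OF assms]]
  by (simp_all add: matrix_eq flip: matrix_vector_mul_assoc)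

lemma fixing_scale: "k \<noteq> 0 \<Longrightarrow> fixing S (k *s v) = fixing S v"
  by (auto simp: fixing_def vector_scalar_commute)

text \<open>
  The second set \<open>T'\<close> makes the statement apply to the two cosets of the subgroup of index two
  as well as to a group itself.
\<close>

lemma card_fixing_coset:
  assumes "M \<in> symmetries" and T: "\<And>P. M ** P \<in> T' \<longleftrightarrow> P \<in> T"
  shows "card {N \<in> T'. N *v v = M *v v} = card (fixing T v)"
proof -
  have "{N \<in> T'. N *v v = M *v v} = (\<lambda>P. M ** P) ` fixing T v"
  proof (intro Set.set_eqI iffI)
    fix N assume N: "N \<in> {N \<in> T'. N *v v = M *v v}"
    have "N = M ** (matrix_inv M ** N)" by (rule matrix_inv_mult(2)[OF assms(1), symmetric])
    moreover have "M ** (matrix_inv M ** N) \<in> T'"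
      using N by (simp add: matrix_inv_mult(2)[OF assms(1)])
    then have "matrix_inv M ** N \<in> T" by (simp only: T)
    moreover have "(matrix_inv M ** N) *v v = v"
      using N matrix_inv_vector(2)[OF symmetry_invertible[OF assms(1)]]
      by (simp flip: matrix_vector_mul_assoc)
    ultimately show "N \<in> (\<lambda>P. M ** P) ` fixing T v" by (auto simp: fixing_def)
  qed (use T in \<open>auto simp: fixing_def simp flip: matrix_vector_mul_assoc\<close>)
  moreover have "inj_on (\<lambda>P. M ** P) (fixing T v)"
    by (rule inj_on_inverseI[of _ "\<lambda>N. matrix_inv M ** N"]) (simp add: assms(1) matrix_inv_mult)
  ultimately show ?thesis by (simp add: card_image)
qed

lemma group_mult_mem_iff:
  assumes "matrix_group S" "M \<in> S"
  shows "M ** P \<in> S \<longleftrightarrow> P \<in> S"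
proof
  have M: "M \<in> symmetries" "matrix_inv M \<in> S" using assms by (auto simp: matrix_group_def)
  assume "M ** P \<in> S"
  then have "matrix_inv M ** (M ** P) \<in> S" using assms(1) M(2) by (simp add: matrix_group_def)
  then show "P \<in> S" by (simp add: matrix_inv_mult(1)[OF M(1)])
qed (use assms in \<open>simp add: matrix_group_def\<close>)

lemma card_fixing_image:
  assumes S: "matrix_group S" and N: "N \<in> S"
  shows "card (fixing S (N *v v)) = card (fixing S v)"
proof -
  have N': "N \<in> symmetries" "matrix_inv N \<in> symmetries" "matrix_inv N \<in> S"
    using S N symmetries_matrix_inv unfolding matrix_group_def by auto
  note inv = matrix_inv_vector[OF symmetry_invertible[OF N'(1)]]
  have "bij_betw (\<lambda>P. N ** P ** matrix_inv N) (fixing S v) (fixing S (N *v v))"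
  proof (rule bij_betw_byWitness[where f' = "\<lambda>P. matrix_inv N ** P ** N"])
    show "(\<lambda>P. N ** P ** matrix_inv N) ` fixing S v \<subseteq> fixing S (N *v v)"
      "(\<lambda>P. matrix_inv N ** P ** N) ` fixing S (N *v v) \<subseteq> fixing S v"
      using S N N' inv unfolding matrix_group_def
      by (auto simp: fixing_def simp flip: matrix_vector_mul_assoc)
  qed (auto simp: matrix_eq inv simp flip: matrix_vector_mul_assoc)
  then show ?thesis by (simp add: bij_betw_same_card)
qed

lemma card_lines_through:
  assumes "x \<noteq> 0"
  shows "card {l \<in> graph_line ` S. vec.span {x} \<in> l} = card {M \<in> S. lower x = M *v upper x}"
proof -
  have "{l \<in> graph_line ` S. vec.span {x} \<in> l} = graph_line ` {M \<in> S. lower x = M *v upper x}"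
    using assms by auto
  then show ?thesis by (simp add: card_image inj_on_def)
qed

lemma P3_cases:
  assumes "p \<in> P3"
  obtains x where "x \<noteq> 0" "p = vec.span {x}"
  using assms by (auto simp: P3_def projectivization_def)

lemma span_mem_P3: "x \<noteq> 0 \<Longrightarrow> vec.span {x} \<in> P3"
  by (auto simp: P3_def projectivization_def)

lemma points_of_mult_group:
  assumes S: "matrix_group S" and D: "set_mset D = graph_line ` S" and "r > 0"
  shows "points_of_mult D r
    = {vec.span {join v (M *v v)} | M v. M \<in> S \<and> v \<noteq> 0 \<and> card (fixing S v) = r}"
proof -
  have coset: "card {N \<in> S. M *v v = N *v v} = card (fixing S v)" if "M \<in> S" for M v
  proof -
    have "M \<in> symmetries" using S that by (auto simp: matrix_group_def)
    from card_fixing_coset[OF this group_mult_mem_iff[OF S that]]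
    show ?thesis by (simp add: eq_commute)
  qed
  show ?thesis
  proof (intro Set.set_eqI iffI)
    fix p assume p: "p \<in> points_of_mult D r"
    then obtain x where x: "x \<noteq> 0" "p = vec.span {x}"
      by (auto simp: points_of_mult_def elim: P3_cases)
    have card: "card {M \<in> S. lower x = M *v upper x} = r"
      using p x by (simp add: points_of_mult_def D card_lines_through)
    then have "{M \<in> S. lower x = M *v upper x} \<noteq> {}" using \<open>r > 0\<close> by (metis card.empty less_irrefl)
    then obtain M where M: "M \<in> S" "lower x = M *v upper x" by blast
    define v where "v = upper x"
    have x_eq: "x = join v (M *v v)" using M(2) by (metis join_upper_lower(3) v_def)
    then have "v \<noteq> 0" using x(1) by auto
    moreover have "card (fixing S v) = r" using card coset[OF M(1)] M(2) by (simp add: v_def)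
    moreover have "p = vec.span {join v (M *v v)}" using x(2) by (simp only: x_eq)
    ultimately show "p \<in> {vec.span {join v (M *v v)} | M v. M \<in> S \<and> v \<noteq> 0 \<and> card (fixing S v) = r}"
      using M(1) by blast
  next
    fix p assume "p \<in> {vec.span {join v (M *v v)} | M v. M \<in> S \<and> v \<noteq> 0 \<and> card (fixing S v) = r}"
    then obtain M v where "p = vec.span {join v (M *v v)}" "M \<in> S" "v \<noteq> 0" "card (fixing S v) = r"
      by blast
    then show "p \<in> points_of_mult D r"
      by (simp add: points_of_mult_def D card_lines_through coset span_mem_P3)
  qed
qed

text \<open>
  Double counting of incidences. \<open>R\<close> holds one vector for each direction whose stabilizer has
  order \<open>r\<close>, so each line carries \<open>card R\<close> points of multiplicity \<open>r\<close>, while each of these points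
  lies on \<open>r\<close> lines.
\<close>

lemma card_points_of_mult:
  assumes S: "matrix_group S" and D: "set_mset D = graph_line ` S" and "r > 0"
    and fin: "finite S" "finite R"
    and R: "\<And>\<rho>. \<rho> \<in> R \<Longrightarrow> \<rho> \<noteq> 0 \<and> card (fixing S \<rho>) = r"
    and cover: "\<And>v. v \<noteq> 0 \<Longrightarrow> card (fixing S v) = r \<Longrightarrow> \<exists>k. \<exists>\<rho>\<in>R. v = k *s \<rho>"
    and unique: "\<And>\<rho> \<rho>' k. \<rho> \<in> R \<Longrightarrow> \<rho>' \<in> R \<Longrightarrow> \<rho> = k *s \<rho>' \<Longrightarrow> \<rho> = \<rho>'"
  shows "finite (points_of_mult D r)" "r * card (points_of_mult D r) = card S * card R"
proof -
  define f where "f = (\<lambda>(M, \<rho>). vec.span {join \<rho> (M *v \<rho>)})"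
  have image: "points_of_mult D r = f ` (S \<times> R)"
  proof -
    have "vec.span {join v (M *v v)} \<in> f ` (S \<times> R)"
      if "M \<in> S" and v0: "v \<noteq> 0" "card (fixing S v) = r" for M v
    proof -
      obtain k \<rho> where v: "v = k *s \<rho>" "\<rho> \<in> R" using cover[OF v0] by blast
      have "k \<noteq> 0" using \<open>v \<noteq> 0\<close> v(1) vector_smult_lzero by blast
      have "join v (M *v v) \<noteq> 0" using \<open>v \<noteq> 0\<close> by simp
      then have "vec.span {join v (M *v v)} = f (M, \<rho>)"
        unfolding f_def prod.case
        using \<open>k \<noteq> 0\<close> unfolding span_eq_span_iff[OF \<open>join v (M *v v) \<noteq> 0\<close>]
        by (intro exI[of _ k]) (simp add: v(1) join_linear vector_scalar_commute)
      then show ?thesis using that v by blast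
    qed
    moreover have "\<exists>N v. f z = vec.span {join v (N *v v)} \<and> N \<in> S \<and> v \<noteq> 0 \<and> card (fixing S v) = r"
      if "z \<in> S \<times> R" for z
      using that R[of "snd z"] by (intro exI[of _ "fst z"] exI[of _ "snd z"]) (auto simp: f_def)
    ultimately show ?thesis unfolding points_of_mult_group[OF S D \<open>r > 0\<close>] by blast
  qed
  then show "finite (points_of_mult D r)" using fin by simp
  have fibre: "card {z \<in> S \<times> R. f z = p} = r" if p: "p \<in> f ` (S \<times> R)" for p
  proof -
    obtain M \<rho> where M: "M \<in> S" "\<rho> \<in> R" "p = f (M, \<rho>)" using p by blast
    have "{z \<in> S \<times> R. f z = p} = {N \<in> S. N *v \<rho> = M *v \<rho>} \<times> {\<rho>}"
    proof (intro Set.set_eqI iffI)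
      fix z assume z: "z \<in> {z \<in> S \<times> R. f z = p}"
      then obtain N \<sigma> where N: "z = (N, \<sigma>)" "N \<in> S" "\<sigma> \<in> R" by auto
      then have "join \<sigma> (N *v \<sigma>) \<noteq> 0" using R by simp
      then obtain k where k: "k \<noteq> 0" "join \<sigma> (N *v \<sigma>) = k *s join \<rho> (M *v \<rho>)"
        using z N M span_eq_span_iff[of "join \<sigma> (N *v \<sigma>)"] by (auto simp: f_def)
      then have "\<sigma> = \<rho>" using unique N M by (auto simp: join_linear)
      with k R[OF M(2)] have "k = 1" by (auto simp: join_linear vec2_eq_iff)
      with k \<open>\<sigma> = \<rho>\<close> N show "z \<in> {N \<in> S. N *v \<rho> = M *v \<rho>} \<times> {\<rho>}" by simp
    qed (use M in \<open>auto simp: f_def\<close>)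
    moreover have "card {N \<in> S. N *v \<rho> = M *v \<rho>} = card (fixing S \<rho>)"
      using S M group_mult_mem_iff[OF S M(1)]
      by (intro card_fixing_coset) (auto simp: matrix_group_def)
    ultimately show ?thesis using R[OF M(2)] by (simp add: card_cartesian_product)
  qed
  have "card S * card R = (\<Sum>z\<in>S \<times> R. 1)" by (simp add: card_cartesian_product)
  also have "\<dots> = (\<Sum>p\<in>f ` (S \<times> R). \<Sum>z | z \<in> S \<times> R \<and> f z = p. 1)"
    using fin by (intro sum.image_gen) simp
  also have "\<dots> = (\<Sum>p\<in>f ` (S \<times> R). r)" using fibre by (intro sum.cong) auto
  finally show "r * card (points_of_mult D r) = card S * card R" by (simp add: image)
qed

section \<open>The two determinant classes\<close>

text \<open>
  The determinants of the symmetries are sixth roots of unity, so their cubes are \<open>1\<close> or \<open>- 1\<close>.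
  The class of \<open>1\<close> is the subgroup of index two whose graph lines are the 24 given ones; the class
  of \<open>- 1\<close> is its other coset and gives their images under \<open>alpha\<close>.
\<close>

definition det_class :: "complex \<Rightarrow> (complex^2^2) set" where
  "det_class e = {M \<in> symmetries. Determinants.det M ^ 3 = e}"

lemma det_cube_diagonal: "a^4 = 1 \<Longrightarrow> \<zeta>^3 = 1 \<Longrightarrow> Determinants.det (diagonal a \<zeta>) ^ 3 = a^2"
  unfolding det_diagonal by Groebner_Basis.algebra

lemma det_cube_mixing:
  "9 * a^4 = 1 \<Longrightarrow> \<omega>^3 = 1 \<Longrightarrow> \<zeta>^3 = 1 \<Longrightarrow> Determinants.det (mixing a \<omega> \<zeta>) ^ 3 = - 3 * a^2"
  unfolding det_mixing by Groebner_Basis.algebra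

lemma symmetries_eq_det_classes:
  "symmetries = det_class 1 \<union> det_class (- 1)" "det_class 1 \<inter> det_class (- 1) = {}"
proof -
  have "M \<in> det_class 1 \<union> det_class (- 1)" if "M \<in> symmetries" for M
    using that
  proof (cases rule: symmetries_cases)
    case (diagonal a \<zeta>)
    have "(a^2 - 1) * (a^2 + 1) = 0" using diagonal(1) by Groebner_Basis.algebra
    then have "a^2 = 1 \<or> a^2 = - 1" by (auto simp: eq_neg_iff_add_eq_0)
    then show ?thesis
      using that det_cube_diagonal[OF diagonal(1,2)] diagonal(3) by (auto simp: det_class_def)
  next
    case (mixing a \<omega> \<zeta>)
    have "(- 3 * a^2 - 1) * (- 3 * a^2 + 1) = 0" using mixing(1) by Groebner_Basis.algebra
    then have "- 3 * a^2 = 1 \<or> - 3 * a^2 = - 1" by (auto simp: add_eq_0_iff)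
    then show ?thesis
      using that det_cube_mixing[OF mixing(1-3)] mixing(4) by (auto simp: det_class_def)
  qed
  then show "symmetries = det_class 1 \<union> det_class (- 1)" by (auto simp: det_class_def)
  show "det_class 1 \<inter> det_class (- 1) = {}" by (auto simp: det_class_def)
qed

lemma det_class_eq:
  assumes "e^2 = 1"
  shows "det_class e = case_prod diagonal ` ({a. a^2 = e} \<times> {\<zeta>. \<zeta>^3 = 1})
    \<union> (\<lambda>(a, \<omega>, \<zeta>). mixing a \<omega> \<zeta>) ` ({a. a^2 = - e / 3} \<times> {\<omega>. \<omega>^3 = 1} \<times> {\<zeta>. \<zeta>^3 = 1})"
    (is "_ = ?A \<union> ?B")
proof -
  have a4: "a^4 = 1" if "a^2 = e" for a
  proof -
    have "a^4 = (a^2)^2" by Groebner_Basis.algebra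
    then show ?thesis using that assms by simp
  qed
  have b4: "9 * a^4 = 1" if "a^2 = - e / 3" for a
  proof -
    have "9 * a^4 = (- 3 * a^2)^2" by Groebner_Basis.algebra
    then show ?thesis using that assms by simp
  qed
  show ?thesis
  proof (intro Set.set_eqI iffI)
    fix M assume "M \<in> det_class e"
    then have M: "M \<in> symmetries" "Determinants.det M ^ 3 = e" by (auto simp: det_class_def)
    from M(1) show "M \<in> ?A \<union> ?B"
    proof (cases rule: symmetries_cases)
      case (diagonal a \<zeta>)
      then have "(a, \<zeta>) \<in> {a. a^2 = e} \<times> {\<zeta>. \<zeta>^3 = 1}" using M det_cube_diagonal by auto
      then show ?thesis unfolding diagonal by force
    next
      case (mixing a \<omega> \<zeta>)
      then have e: "e = - 3 * a^2" using M det_cube_mixing by auto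
      have "a^2 = - e / 3" unfolding e by simp
      with mixing show ?thesis by force
    qed
  next
    fix M assume "M \<in> ?A \<union> ?B"
    then show "M \<in> det_class e"
      using a4 b4
      by (auto simp: det_class_def diagonal_symmetry mixing_symmetry det_cube_diagonal det_cube_mixing)
  qed
qed

lemma card_square_roots: "c \<noteq> 0 \<Longrightarrow> card {a::complex. a^2 = c} = 2"
  by (rule card_nth_roots) auto

lemma card_cube_roots_of_unity: "card {\<zeta>::complex. \<zeta>^3 = 1} = 3"
  by (rule card_nth_roots) auto

lemma finite_roots: "n > 0 \<Longrightarrow> finite {a::complex. a^n = c}"
  by (rule finite_nth_roots)

lemma det_class_finite_card:
  assumes "e^2 = 1"
  shows "finite (det_class e)" "card (det_class e) = 24"
proof -
  let ?\<mu> = "{\<zeta>::complex. \<zeta>^3 = 1}"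
  let ?A = "{a. a^2 = e} \<times> ?\<mu>" and ?B = "{a. a^2 = - e / 3} \<times> ?\<mu> \<times> ?\<mu>"
  have "e \<noteq> 0" using assms by auto
  have fin: "finite ?A" "finite ?B" by (simp_all add: finite_roots)
  show "finite (det_class e)" unfolding det_class_eq[OF assms] using fin by simp
  have nz: "a \<noteq> 0" if "a^2 = e \<or> a^2 = - e / 3" for a using that \<open>e \<noteq> 0\<close> by auto
  have "inj_on (case_prod diagonal) ?A"
    using nz by (auto simp: inj_on_def diagonal_def mat2_eq_iff)
  moreover have "inj_on (\<lambda>(a, \<omega>, \<zeta>). mixing a \<omega> \<zeta>) ?B"
    using nz by (auto simp: inj_on_def vec2_eq_iff)
  moreover have "diagonal a \<zeta> \<noteq> mixing a' \<omega> \<zeta>'" if "a' \<noteq> 0" "\<zeta>'^3 = 1" for a \<zeta> a' \<omega> \<zeta>'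
    using that by (auto simp: vec2_eq_iff)
  then have "case_prod diagonal ` ?A \<inter> (\<lambda>(a, \<omega>, \<zeta>). mixing a \<omega> \<zeta>) ` ?B = {}"
    using nz by auto
  ultimately show "card (det_class e) = 24"
    unfolding det_class_eq[OF assms] using fin \<open>e \<noteq> 0\<close>
    by (simp add: card_Un_disjoint card_image card_cartesian_product card_square_roots
        card_cube_roots_of_unity)
qed

lemma symmetries_finite_card: "finite symmetries" "card symmetries = 48"
  unfolding symmetries_eq_det_classes(1)
  using det_class_finite_card[of 1] det_class_finite_card[of "- 1"] symmetries_eq_det_classes(2)
  by (simp_all add: card_Un_disjoint)

lemma matrix_group_symmetries: "matrix_group symmetries"
  by (simp add: matrix_group_def one_symmetry symmetries_mult symmetries_matrix_inv)

lemma det_class_mult_iff: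
  assumes "M \<in> det_class e" "e^2 = 1"
  shows "M ** P \<in> det_class (e * e') \<longleftrightarrow> P \<in> det_class e'"
proof -
  have "e \<noteq> 0" using assms by auto
  then show ?thesis
    using assms group_mult_mem_iff[OF matrix_group_symmetries, of M P]
    by (auto simp: det_class_def det_mul power_mult_distrib)
qed

lemma matrix_group_det_class: "matrix_group (det_class 1)"
proof -
  have I: "id2 \<in> det_class 1" by (simp add: det_class_def one_symmetry)
  have "matrix_inv M \<in> det_class 1" if M: "M \<in> det_class 1" for M
  proof -
    have "M ** matrix_inv M = id2"
      using M matrix_inv_mult(2)[of M id2] by (simp add: det_class_def)
    then show ?thesis using det_class_mult_iff[OF M, of "matrix_inv M" 1] I by simp
  qed
  then show ?thesis
    using I det_class_mult_iff[of _ 1 _ 1] by (auto simp: matrix_group_def) (simp add: det_class_def)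
qed

section \<open>Reflections\<close>

text \<open>
  One vector on each zero of the Hessian of \<open>phi\<close>, which is proportional to $t (8 s^3 + t^3)$:
  the axes of the reflections of order three.
\<close>

definition triple_axes :: "(complex^2) set" where
  "triple_axes = insert (vector [1, 0]) ((\<lambda>\<eta>. vector [\<eta>, - 2]) ` {\<eta>. \<eta>^3 = 1})"

text \<open>
  One vector on each zero of the sextic covariant $t^6 - 20 s^3 t^3 - 8 s^6$ of \<open>phi\<close>: the axes of
  the reflections of order two.
\<close>

definition double_axes :: "(complex^2) set" where
  "double_axes = (\<lambda>(\<zeta>, a). vector [\<zeta>, 1 - 3 * a]) ` ({\<zeta>. \<zeta>^3 = 1} \<times> {a. 3 * a^2 = 1})"

text \<open>
  A symmetry fixing a vector satisfies \<open>det (M - 1) = 0\<close>. For a mixing matrix this is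
  \<open>1 - a (1 - \<kappa>) - 3 a^2 \<kappa> = 0\<close> with \<open>\<kappa> = \<omega> \<zeta>\<close>, and \<open>3 a^2 = 1\<close> or \<open>3 a^2 = - 1\<close>. In the first
  case \<open>\<kappa> = 1\<close> is forced and there is one reflection for each pair \<open>(a, \<zeta>)\<close>; in the second one
  \<open>\<kappa>\<close> is a primitive cube root of unity.
\<close>

lemma reflections:
  assumes M: "M \<in> symmetries" "M \<noteq> id2" and v: "M *v v = v" "v \<noteq> 0"
  obtains (order3) k \<rho> where "M \<in> det_class 1" "\<rho> \<in> triple_axes" "v = k *s \<rho>"
    | (order2) a \<zeta> k where "3 * a^2 = 1" "\<zeta>^3 = 1" "M = mixing a (\<zeta>^2) \<zeta>"
        "v = k *s vector [\<zeta>, 1 - 3 * a]"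
  using M(1)
proof (cases rule: symmetries_cases)
  case (diagonal a \<zeta>)
  have eq: "a * v$1 = v$1" "a * \<zeta> * v$2 = v$2"
    using v diagonal by (auto simp: vec2_eq_iff)
  have id: "M = id2" if "a = 1" "\<zeta> = 1"
    by (simp add: that diagonal vec2_eq_iff Finite_Cartesian_Product.mat_def)
  show thesis
  proof (cases "v$1 = 0")
    case True
    then have "a * \<zeta> = 1" using eq v by (auto simp: vec2_eq_iff)
    then have "a = 1" using diagonal(1,2) by Groebner_Basis.algebra
    then show thesis using id \<open>a * \<zeta> = 1\<close> M by simp
  next
    case False
    then have "a = 1" using eq by simp
    then have "\<zeta> \<noteq> 1" using id M by auto
    then have "v = v$1 *s vector [1, 0]" using eq \<open>a = 1\<close> by (auto simp: vec2_eq_iff)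
    moreover have "M \<in> det_class 1"
      using M(1) diagonal det_cube_diagonal \<open>a = 1\<close> by (simp add: det_class_def)
    ultimately show thesis using order3 by (auto simp: triple_axes_def)
  qed
next
  case (mixing a \<omega> \<zeta>)
  define s t where "s = v$1" and "t = v$2"
  have eq: "a * (s - \<zeta> * t) = s" "- a * \<omega> * (2 * s + \<zeta> * t) = t"
    using v mixing by (auto simp: vec2_eq_iff s_def t_def algebra_simps)
  then have eq0: "a * (s - \<zeta> * t) - s = 0" "- a * \<omega> * (2 * s + \<zeta> * t) - t = 0" by simp_all
  define \<kappa> where "\<kappa> = \<omega> * \<zeta>"
  have nz: "a \<noteq> 0" "\<omega> \<noteq> 0" "\<zeta> \<noteq> 0" using mixing by auto
  have st: "s \<noteq> 0 \<or> t \<noteq> 0" using v by (auto simp: vec2_eq_iff s_def t_def)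
  have "(1 - a * (1 - \<kappa>) - 3 * a^2 * \<kappa>) * s = 0" "(1 - a * (1 - \<kappa>) - 3 * a^2 * \<kappa>) * t = 0"
    using eq0 unfolding \<kappa>_def by Groebner_Basis.algebra+
  then have char: "1 - a * (1 - \<kappa>) - 3 * a^2 * \<kappa> = 0" using st by auto
  have "(3 * a^2 - 1) * (3 * a^2 + 1) = 0" using mixing(1) by Groebner_Basis.algebra
  then consider "3 * a^2 = 1" | "3 * a^2 = - 1" by (auto simp: eq_neg_iff_add_eq_0)
  then show thesis
  proof cases
    case 1
    have "a \<noteq> 1" using 1 by auto
    have "(1 - \<kappa>) * (1 - a) = 0" using char 1 by Groebner_Basis.algebra
    then have "\<kappa> = 1" using \<open>a \<noteq> 1\<close> by simp
    then have "\<omega> = \<zeta>^2"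
      using mixing(2,3) unfolding \<kappa>_def by Groebner_Basis.algebra
    then have M_eq: "M = mixing a (\<zeta>^2) \<zeta>" using mixing(4) by simp
    have "(1 - 3 * a) * s = \<zeta> * t" using eq0(1) 1 by Groebner_Basis.algebra
    then have "v = (s / \<zeta>) *s vector [\<zeta>, 1 - 3 * a]"
      using nz by (simp add: vec2_eq_iff flip: s_def t_def) (simp add: field_simps)
    then show thesis by (rule order2[OF 1 mixing(3) M_eq])
  next
    case 2
    have \<kappa>: "\<kappa>^2 + \<kappa> + 1 = 0" using char 2 by Groebner_Basis.algebra
    have "a \<noteq> 1" using 2 by auto
    \<comment> \<open>the axis is \<open>(\<eta>, - 2)\<close> with \<open>\<eta> = \<omega> * \<zeta>^2\<close>; the factor \<open>a - 1\<close> comes from the first equation\<close>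
    have "(a - 1) * (2 * s + \<omega> * \<zeta>^2 * t) = \<zeta> * t * (2 * a + (a - 1) * \<kappa>)"
      using eq0(1) unfolding \<kappa>_def by Groebner_Basis.algebra
    moreover have "2 * a + (a - 1) * \<kappa> = 0" using char 2 \<kappa> by Groebner_Basis.algebra
    ultimately have "2 * s + \<omega> * \<zeta>^2 * t = 0"
      using \<open>a \<noteq> 1\<close> by (simp only: mult_zero_right mult_eq_0_iff) simp
    then have v_eq: "v = (- t / 2) *s vector [\<omega> * \<zeta>^2, - 2]"
      by (simp add: vec2_eq_iff flip: s_def t_def) (simp add: field_simps add_eq_0_iff)
    have "(\<omega> * \<zeta>^2)^3 = 1" using mixing(2,3) by Groebner_Basis.algebra
    then have axis: "vector [\<omega> * \<zeta>^2, - 2] \<in> triple_axes" by (simp add: triple_axes_def)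
    have "M \<in> det_class 1"
      using M(1) mixing det_cube_mixing[OF mixing(1-3)] 2 by (simp add: det_class_def)
    then show thesis by (rule order3[OF _ axis v_eq])
  qed
qed

lemma triple_axes_unique:
  assumes "\<rho> \<in> triple_axes" "\<rho>' \<in> triple_axes" "\<rho> = k *s \<rho>'"
  shows "\<rho> = \<rho>'"
  using assms by (auto simp: triple_axes_def vec2_eq_iff)

lemma double_axis_cube: "3 * a^2 = 1 \<Longrightarrow> (1 - 3 * a)^3 = 10 - 18 * a" for a :: complex
proof -
  assume "3 * a^2 = 1"
  then show ?thesis by Groebner_Basis.algebra
qed

lemma double_axis_slope_nonzero:
  fixes a :: complex
  assumes "3 * a^2 = 1"
  shows "1 - 3 * a \<noteq> 0"
proof
  assume "1 - 3 * a = 0"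
  then have "a = 1/3" by (simp add: field_simps)
  with assms show False by (simp add: power2_eq_square)
qed

text \<open>
  Proportional vectors have equal ratios of the cubes of their entries, and \<open>10 - 18 a\<close>
  determines \<open>a\<close>.
\<close>

lemma double_axis_params_unique:
  assumes "3 * a^2 = 1" "3 * a'^2 = 1" "\<zeta>^3 = 1" "\<zeta>'^3 = 1"
    and "vector [\<zeta>, 1 - 3 * a] = k *s (vector [\<zeta>', 1 - 3 * a'] :: complex^2)"
  shows "a = a' \<and> \<zeta> = \<zeta>'"
proof -
  have k: "\<zeta> = k * \<zeta>'" "1 - 3 * a = k * (1 - 3 * a')" using assms by (auto simp: vec2_eq_iff)
  have "k^3 = 1" using k(1) assms(3,4) by Groebner_Basis.algebra
  then have "(1 - 3 * a)^3 = (1 - 3 * a')^3" using k(2) by (simp add: power_mult_distrib)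
  then have "a = a'" using assms by (simp add: double_axis_cube)
  moreover have "1 - 3 * a' \<noteq> 0" using assms(2) by (rule double_axis_slope_nonzero)
  ultimately show ?thesis using k by simp
qed

lemma double_axes_unique:
  assumes "\<rho> \<in> double_axes" "\<rho>' \<in> double_axes" "\<rho> = k *s \<rho>'"
  shows "\<rho> = \<rho>'"
proof -
  from assms(1) obtain \<zeta> a where 1: "\<rho> = vector [\<zeta>, 1 - 3 * a]" "\<zeta>^3 = 1" "3 * a^2 = 1"
    by (auto simp: double_axes_def)
  from assms(2) obtain \<zeta>' a' where 2: "\<rho>' = vector [\<zeta>', 1 - 3 * a']" "\<zeta>'^3 = 1" "3 * a'^2 = 1"
    by (auto simp: double_axes_def)
  have "vector [\<zeta>, 1 - 3 * a] = k *s (vector [\<zeta>', 1 - 3 * a'] :: complex^2)"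
    using assms(3) by (simp only: 1(1) 2(1))
  from double_axis_params_unique[OF 1(3) 2(3) 1(2) 2(2) this] show ?thesis by (simp add: 1(1) 2(1))
qed

text \<open>
  Again by comparing cubes: proportionality would force \<open>10 - 18 a = - 8\<close>, that is \<open>a = 1\<close>.
\<close>

lemma axes_disjoint:
  assumes "\<rho> \<in> triple_axes" "\<sigma> \<in> double_axes"
  shows "\<rho> \<noteq> k *s \<sigma>"
proof
  assume eq: "\<rho> = k *s \<sigma>"
  from assms(2) obtain \<zeta> a where \<sigma>: "\<sigma> = vector [\<zeta>, 1 - 3 * a]" "\<zeta>^3 = 1" "3 * a^2 = 1"
    by (auto simp: double_axes_def)
  have nz: "1 - 3 * a \<noteq> 0" using \<sigma>(3) by (rule double_axis_slope_nonzero)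
  have \<rho>: "\<rho>$1 = k * \<zeta>" "\<rho>$2 = k * (1 - 3 * a)" by (simp_all add: eq \<sigma>(1))
  consider "\<rho> = vector [1, 0]" | \<eta> where "\<eta>^3 = 1" "\<rho> = vector [\<eta>, - 2]"
    using assms(1) by (auto simp: triple_axes_def)
  then show False
  proof cases
    case 1
    with \<rho> nz show False by auto
  next
    case 2
    with \<rho> have k: "k * \<zeta> = \<eta>" "k * (1 - 3 * a) = - 2" by auto
    have "(k * \<zeta>)^3 = 1" using k(1) 2(1) by simp
    then have "k^3 = 1" using \<sigma>(2) by (simp add: power_mult_distrib)
    then have "(1 - 3 * a)^3 = (- 2)^3" using k(2) by (metis mult_1 power_mult_distrib)
    then have "10 - 18 * a = - 8" using \<sigma>(3) by (simp add: double_axis_cube)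
    then have "18 * (a - 1) = 0" by (simp add: algebra_simps)
    then have "a = 1" by simp
    with \<sigma>(3) show False by simp
  qed
qed

lemma card_axes: "card triple_axes = 4" "card double_axes = 6"
proof -
  have "inj_on (\<lambda>\<eta>. vector [\<eta>, - 2] :: complex^2) {\<eta>. \<eta>^3 = 1}"
    by (auto simp: inj_on_def vec2_eq_iff)
  moreover have "vector [1, 0] \<notin> (\<lambda>\<eta>. vector [\<eta>, - 2] :: complex^2) ` {\<eta>. \<eta>^3 = 1}"
    by (auto simp: vec2_eq_iff)
  ultimately show "card triple_axes = 4"
    by (simp add: triple_axes_def card_image card_cube_roots_of_unity finite_roots)
  have "inj_on (\<lambda>(\<zeta>, a). vector [\<zeta>, 1 - 3 * a] :: complex^2) ({\<zeta>. \<zeta>^3 = 1} \<times> {a. 3 * a^2 = 1})"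
    by (auto simp: inj_on_def vec2_eq_iff)
  moreover have "{a::complex. 3 * a^2 = 1} = {a. a^2 = 1/3}" by (auto simp: field_simps)
  then have "card {a::complex. 3 * a^2 = 1} = 2" using card_square_roots[of "1/3"] by simp
  ultimately show "card double_axes = 6"
    by (simp add: double_axes_def card_image card_cartesian_product
        card_cube_roots_of_unity)
qed

lemma finite_axes: "finite triple_axes" "finite double_axes"
  using card_axes by (simp_all add: card_ge_0_finite)

lemma axis_nonzero: "\<rho> \<in> triple_axes \<union> double_axes \<Longrightarrow> \<rho> \<noteq> 0"
  by (auto simp: triple_axes_def double_axes_def vec2_eq_iff)

lemma id2_mem_fixing: "id2 \<in> fixing symmetries v"
  by (simp add: fixing_def one_symmetry)

lemma fixing_det_class: "fixing (det_class e) v = fixing symmetries v \<inter> det_class e"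
  by (auto simp: fixing_def det_class_def)

lemma id2_det_class: "id2 \<in> det_class 1" "id2 \<notin> det_class (- 1)"
  using matrix_group_det_class symmetries_eq_det_classes(2) by (auto simp: matrix_group_def)

text \<open>
  For \<open>(1, 0)\<close> the stabilizer consists of the matrices \<open>diag (1, \<zeta>)\<close>; the other three axes are
  images of this one under the group.
\<close>

lemma card_fixing_triple_axis:
  assumes "\<rho> \<in> triple_axes"
  shows "card (fixing symmetries \<rho>) = 3"
proof -
  have e1: "card (fixing symmetries (vector [1, 0])) = 3"
  proof -
    have "fixing symmetries (vector [1, 0]) = diagonal 1 ` {\<zeta>. \<zeta>^3 = 1}"
    proof (intro Set.set_eqI iffI)
      fix M assume "M \<in> fixing symmetries (vector [1, 0])"
      then have M: "M \<in> symmetries" "M$1$1 = 1" "M$2$1 = 0" by (auto simp: fixing_def vec2_eq_iff)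
      from M(1) show "M \<in> diagonal 1 ` {\<zeta>. \<zeta>^3 = 1}"
        using M(2,3) by (cases rule: symmetries_cases) auto
    qed (auto simp: fixing_def diagonal_symmetry vec2_eq_iff)
    moreover have "inj_on (diagonal 1) {\<zeta>. \<zeta>^3 = 1}" by (auto simp: inj_on_def vec2_eq_iff)
    ultimately show ?thesis by (simp add: card_image card_cube_roots_of_unity)
  qed
  consider "\<rho> = vector [1, 0]" | \<eta> where "\<eta>^3 = 1" "\<rho> = vector [\<eta>, - 2]"
    using assms by (auto simp: triple_axes_def)
  then show ?thesis
  proof cases
    case 2
    obtain a :: complex where a: "9 * a^4 = 1"
    proof -
      define b where "b = csqrt (1/3)"
      have "3 * b^2 = 1" unfolding b_def power2_csqrt by simp
      then have "9 * b^4 = 1" by Groebner_Basis.algebra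
      then show thesis by (rule that)
    qed
    then have "a \<noteq> 0" by auto
    have "(\<eta>^2)^3 = 1" using 2(1) by Groebner_Basis.algebra
    with a have N: "mixing a (\<eta>^2) 1 \<in> symmetries" by (intro mixing_symmetry) auto
    \<comment> \<open>this mixing matrix sends \<open>(1, 0)\<close> to \<open>(a, - 2 a / \<eta>)\<close>\<close>
    have "\<eta> * \<eta>^2 = 1" using 2(1) by Groebner_Basis.algebra
    then have "\<rho> = (\<eta> / a) *s (mixing a (\<eta>^2) 1 *v vector [1, 0])"
      using 2(2) \<open>a \<noteq> 0\<close> by (simp add: vec2_eq_iff)
    moreover have "\<eta> / a \<noteq> 0" using 2(1) \<open>a \<noteq> 0\<close> by auto
    ultimately show ?thesis
      by (simp add: fixing_scale card_fixing_image[OF matrix_group_symmetries N] e1)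
  qed (simp add: e1)
qed

lemma fixing_triple_axis:
  assumes "v \<noteq> 0" "v = k *s \<rho>" "\<rho> \<in> triple_axes"
  shows "card (fixing (det_class 1) v) = 3" "fixing (det_class (- 1)) v = {}"
proof -
  have "k \<noteq> 0" using assms by auto
  have sub: "fixing symmetries v \<subseteq> det_class 1"
  proof
    fix M assume "M \<in> fixing symmetries v"
    then have M: "M \<in> symmetries" "M *v v = v" by (auto simp: fixing_def)
    show "M \<in> det_class 1"
    proof (cases "M = id2")
      case False
      from M(1) this M(2) assms(1) show ?thesis
      proof (cases rule: reflections)
        case (order2 a \<zeta> l)
        then have "vector [\<zeta>, 1 - 3 * a] \<in> double_axes" by (auto simp: double_axes_def)
        moreover have "\<rho> = (1 / k) *s v" using assms(2) \<open>k \<noteq> 0\<close> by (simp add: vec2_eq_iff)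
        then have "\<rho> = (l / k) *s vector [\<zeta>, 1 - 3 * a]" by (simp add: order2(4) vec2_eq_iff)
        ultimately show ?thesis using axes_disjoint[OF assms(3)] by blast
      qed
    qed (simp add: id2_det_class)
  qed
  then have "fixing (det_class 1) v = fixing symmetries v" by (auto simp: fixing_det_class)
  then show "card (fixing (det_class 1) v) = 3"
    using card_fixing_triple_axis[OF assms(3)] \<open>k \<noteq> 0\<close> by (simp add: assms(2) fixing_scale)
  show "fixing (det_class (- 1)) v = {}"
    using sub symmetries_eq_det_classes(2) by (auto simp: fixing_det_class)
qed

lemma fixing_double_axis:
  assumes "v \<noteq> 0" "v = k *s \<rho>" "\<rho> \<in> double_axes"
  shows "card (fixing (det_class 1) v) = 1" "card (fixing (det_class (- 1)) v) = 1"
proof -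
  have "k \<noteq> 0" using assms by auto
  from assms(3) obtain \<zeta> a where \<rho>: "\<rho> = vector [\<zeta>, 1 - 3 * a]" "\<zeta>^3 = 1" "3 * a^2 = 1"
    by (auto simp: double_axes_def)
  note a = \<rho>(3)
  define R where "R = mixing a (\<zeta>^2) \<zeta>"
  have a4: "9 * a^4 = 1" using a by Groebner_Basis.algebra
  have \<zeta>6: "(\<zeta>^2)^3 = 1" using \<rho>(2) by Groebner_Basis.algebra
  have R: "R \<in> det_class (- 1)"
    using a a4 \<zeta>6 \<rho>(2) by (simp add: R_def det_class_def mixing_symmetry det_cube_mixing)
  have "R *v \<rho> = \<rho>"
  proof -
    have "a * \<zeta> - a * \<zeta> * (1 - 3 * a) = \<zeta>" "- 2 * a * \<zeta>^2 * \<zeta> - a * \<zeta>^2 * \<zeta> * (1 - 3 * a) = 1 - 3 * a"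
      using a \<rho>(2) by Groebner_Basis.algebra+
    then show ?thesis by (simp add: R_def \<rho>(1) vec2_eq_iff)
  qed
  then have Rv: "R *v v = v" by (simp add: assms(2) vector_scalar_commute)
  have "fixing symmetries v = {id2, R}"
  proof (intro equalityI subsetI)
    fix M assume "M \<in> fixing symmetries v"
    then have M: "M \<in> symmetries" "M *v v = v" by (auto simp: fixing_def)
    show "M \<in> {id2, R}"
    proof (cases "M = id2")
      case False
      from M(1) this M(2) assms(1) show ?thesis
      proof (cases rule: reflections)
        case (order3 l \<rho>')
        then have "l \<noteq> 0" using assms(1) by auto
        then have "\<rho>' = (1 / l) *s v" by (simp add: order3(3) vec2_eq_iff)
        then have "\<rho>' = (k / l) *s \<rho>" by (simp add: assms(2) vec2_eq_iff)
        then show ?thesis using axes_disjoint[OF order3(2) assms(3)] by blast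
      next
        case (order2 a' \<zeta>' l)
        have "\<rho> = (1 / k) *s v" using assms(2) \<open>k \<noteq> 0\<close> by (simp add: vec2_eq_iff)
        then have "vector [\<zeta>, 1 - 3 * a] = (l / k) *s (vector [\<zeta>', 1 - 3 * a'] :: complex^2)"
          unfolding \<rho>(1) order2(4) by (simp add: vec2_eq_iff)
        from double_axis_params_unique[OF \<rho>(3) order2(1) \<rho>(2) order2(2) this]
        show ?thesis by (simp add: R_def order2(3))
      qed
    qed simp
  qed (use R Rv in \<open>auto simp: fixing_def det_class_def one_symmetry\<close>)
  moreover have "R \<notin> det_class 1" using R symmetries_eq_det_classes(2) by auto
  ultimately have "fixing (det_class 1) v = {id2}" "fixing (det_class (- 1)) v = {R}"
    using R id2_det_class by (auto simp: fixing_det_class)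
  then show "card (fixing (det_class 1) v) = 1" "card (fixing (det_class (- 1)) v) = 1" by simp_all
qed

lemma fixing_generic:
  assumes "v \<noteq> 0" "\<And>k \<rho>. \<rho> \<in> triple_axes \<union> double_axes \<Longrightarrow> v \<noteq> k *s \<rho>"
  shows "card (fixing (det_class 1) v) = 1" "fixing (det_class (- 1)) v = {}"
proof -
  have "M = id2" if "M \<in> fixing symmetries v" for M
  proof (rule ccontr)
    assume "M \<noteq> id2"
    have "M \<in> symmetries" "M *v v = v" using that by (auto simp: fixing_def)
    from this(1) \<open>M \<noteq> id2\<close> this(2) assms(1) show False
    proof (cases rule: reflections)
      case (order2 a \<zeta> k)
      then have "vector [\<zeta>, 1 - 3 * a] \<in> double_axes" by (auto simp: double_axes_def)
      then show False using assms(2) order2(4) by blast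
    qed (use assms(2) in blast)
  qed
  then have "fixing symmetries v = {id2}" using id2_mem_fixing by blast
  then have "fixing (det_class 1) v = {id2}" "fixing (det_class (- 1)) v = {}"
    using id2_det_class by (auto simp: fixing_det_class)
  then show "card (fixing (det_class 1) v) = 1" "fixing (det_class (- 1)) v = {}" by simp_all
qed

lemma card_fixing_symmetries:
  "card (fixing symmetries v) = card (fixing (det_class 1) v) + card (fixing (det_class (- 1)) v)"
proof -
  have "fixing symmetries v = fixing (det_class 1) v \<union> fixing (det_class (- 1)) v"
    "fixing (det_class 1) v \<inter> fixing (det_class (- 1)) v = {}"
    using symmetries_eq_det_classes by (auto simp: fixing_def)
  moreover have "finite (fixing (det_class e) v)" if "e^2 = 1" for e
    using det_class_finite_card(1)[OF that] by (auto simp: fixing_def)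
  ultimately show ?thesis by (simp add: card_Un_disjoint)
qed

text \<open>
  The stabilizer of a vector in the whole group has order 3, 2 or 1. It lies in the subgroup in
  the first case and is divided evenly between the two classes in the second one.
\<close>

lemma axis_cases:
  assumes "v \<noteq> 0"
  obtains (triple) k \<rho> where "v = k *s \<rho>" "\<rho> \<in> triple_axes"
      "card (fixing (det_class 1) v) = 3" "card (fixing (det_class (- 1)) v) = 0"
    | (double) k \<rho> where "v = k *s \<rho>" "\<rho> \<in> double_axes"
      "card (fixing (det_class 1) v) = 1" "card (fixing (det_class (- 1)) v) = 1"
    | (generic) "card (fixing (det_class 1) v) = 1" "card (fixing (det_class (- 1)) v) = 0"
proof -
  consider k \<rho> where "v = k *s \<rho>" "\<rho> \<in> triple_axes" | k \<rho> where "v = k *s \<rho>" "\<rho> \<in> double_axes"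
    | "\<And>k \<rho>. \<rho> \<in> triple_axes \<union> double_axes \<Longrightarrow> v \<noteq> k *s \<rho>" by blast
  then show thesis
  proof cases
    case (1 k \<rho>)
    then show thesis using fixing_triple_axis[OF assms 1] triple by simp
  next
    case (2 k \<rho>)
    then show thesis using fixing_double_axis[OF assms 2] double by simp
  next
    case 3
    then show thesis using fixing_generic[OF assms] generic by simp
  qed
qed

text \<open>
  This list of possible multiplicities on the two halves contains the whole incidence
  statement: a triple point takes its three lines from one half, a double point takes one from
  each.
\<close>

lemma lines_of_classes_through:
  fixes x :: "complex^4"
  assumes "x \<noteq> 0"
  defines "n \<equiv> \<lambda>e. card {M \<in> det_class e. lower x = M *v upper x}"
  shows "(n 1, n (- 1)) \<in> {(0, 0), (1, 0), (0, 1), (1, 1), (3, 0), (0, 3)}"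
proof (cases "\<exists>M\<in>symmetries. lower x = M *v upper x")
  case False
  then have "{M \<in> det_class e. lower x = M *v upper x} = {}" for e by (auto simp: det_class_def)
  then have "n e = 0" for e unfolding n_def by (metis card.empty)
  then show ?thesis by simp
next
  case True
  then obtain M e where M: "M \<in> det_class e" "lower x = M *v upper x" and e: "e = 1 \<or> e = - 1"
    unfolding symmetries_eq_det_classes by blast
  then have e2: "e^2 = 1" and MS: "M \<in> symmetries" by (auto simp: det_class_def)
  have "upper x \<noteq> 0"
    using assms(1) M(2) by (metis join_eq_0_iff join_upper_lower(3) matrix_vector_mult_0_right)
  have n: "n (e * e') = card (fixing (det_class e') (upper x))" for e'
    using card_fixing_coset[OF MS det_class_mult_iff[OF M(1) e2], of e' "upper x"]
    by (simp add: n_def M(2) eq_commute)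
  show ?thesis
    using \<open>upper x \<noteq> 0\<close> n[of 1] n[of "- 1"] e by (cases rule: axis_cases) auto
qed

section \<open>The listed lines and the automorphism alpha\<close>

text \<open>
  Each of the 24 matrices of the class is found in the list. As the list has only 24 entries,
  it follows without comparing entries that it contains nothing else and no repetition.
\<close>

lemma set_schur_params:
  assumes \<tau>: "\<tau>^2 = - 3"
  shows "set (map line_L (schur_params \<tau>)) = graph_line ` det_class 1"
    and "distinct (map line_L (schur_params \<tau>))"
proof -
  define w1 w2 where "w1 = (- 1 + \<tau>) / 2" and "w2 = (- 1 - \<tau>) / 2"
  define Ms where "Ms = [diagonal 1 1,
    diagonal (- 1) 1,
    diagonal (- 1) w1,
    diagonal (- 1) w2,
    diagonal 1 w2,
    diagonal 1 w1,
    mixing (- \<tau>/3) w1 w1,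
    mixing (- \<tau>/3) 1 w2,
    mixing (- \<tau>/3) w2 1,
    mixing (\<tau>/3) w2 w2,
    mixing (\<tau>/3) 1 w1,
    mixing (\<tau>/3) w1 1,
    mixing (\<tau>/3) w2 w1,
    mixing (\<tau>/3) 1 1,
    mixing (\<tau>/3) w1 w2,
    mixing (- \<tau>/3) w1 w2,
    mixing (- \<tau>/3) 1 1,
    mixing (- \<tau>/3) w2 w1,
    mixing (- \<tau>/3) w1 1,
    mixing (- \<tau>/3) 1 w1,
    mixing (- \<tau>/3) w2 w2,
    mixing (\<tau>/3) w2 1,
    mixing (\<tau>/3) 1 w2,
    mixing (\<tau>/3) w1 w1]"
  have sq: "\<tau> * \<tau> = - 3" using \<tau> by (simp add: power2_eq_square)
  have sq': "\<tau> * (\<tau> * x) = - 3 * x" for x using sq by (metis mult.assoc)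
  have lines: "map line_L (schur_params \<tau>) = map graph_line Ms"
    by (simp add: schur_params_def Ms_def line_L_eq_graph_line vec2_eq_iff w1_def w2_def
        field_simps sq sq')
  have roots: "\<zeta> \<in> {1, w1, w2}" if "\<zeta>^3 = 1" for \<zeta>
  proof -
    have "w1 + w2 = - 1" "w1 * w2 = 1" using sq by (simp_all add: w1_def w2_def field_simps)
    then have "(\<zeta> - 1) * ((\<zeta> - w1) * (\<zeta> - w2)) = 0" using that by Groebner_Basis.algebra
    then show ?thesis by simp
  qed
  have sub: "det_class 1 \<subseteq> set Ms"
  proof
    fix M assume "M \<in> det_class 1"
    then consider a \<zeta> where "a^2 = 1" "\<zeta>^3 = 1" "M = diagonal a \<zeta>"
      | a \<omega> \<zeta> where "a^2 = - 1/3" "\<omega>^3 = 1" "\<zeta>^3 = 1" "M = mixing a \<omega> \<zeta>"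
      using det_class_eq[of 1] by auto
    then show "M \<in> set Ms"
    proof cases
      case (1 a \<zeta>)
      have "a = 1 \<or> a = - 1" using 1(1) by (simp add: power2_eq_1_iff)
      then show ?thesis using roots[OF 1(2)] by (auto simp: 1(3) Ms_def)
    next
      case (2 a \<omega> \<zeta>)
      have "a^2 = (\<tau> / 3)^2" using 2(1) \<tau> by (simp add: power_divide)
      then have "a = \<tau> / 3 \<or> a = - \<tau> / 3" by (simp add: power2_eq_iff)
      then show ?thesis using roots[OF 2(2)] roots[OF 2(3)] by (auto simp: 2(4) Ms_def)
    qed
  qed
  have len: "length Ms = 24" by (simp add: Ms_def)
  have "card (set Ms) \<le> card (det_class 1)"
    using card_length[of Ms] len det_class_finite_card(2)[of 1] by simp
  with sub have set: "set Ms = det_class 1" by (metis card_seteq List.finite_set)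
  then have "distinct Ms" using len det_class_finite_card(2)[of 1] by (simp add: card_distinct)
  then show "distinct (map line_L (schur_params \<tau>))"
    unfolding lines by (simp add: distinct_map inj_on_def)
  show "set (map line_L (schur_params \<tau>)) = graph_line ` det_class 1"
    unfolding lines by (simp add: set)
qed

lemma half_eq:
  assumes "\<tau>^2 = - 3"
  shows "half \<tau> = mset_set (graph_line ` det_class 1)"
  unfolding half_def set_schur_params(1)[OF assms, symmetric]
  by (rule mset_set_set[OF set_schur_params(2)[OF assms], symmetric])

text \<open>
  The action of \<open>alpha\<close> on the second coordinate plane. Its determinant is \<open>- 1\<close>, which is why
  \<open>alpha\<close> interchanges the two determinant classes.
\<close>

definition i_scalar :: "complex^2^2" where
  "i_scalar = mat2 \<i> 0 0 \<i>"

lemma i_scalar_symmetry: "i_scalar \<in> symmetries"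
  unfolding i_scalar_def symmetries_mat2_iff by (simp add: power3_eq_cube)

lemma i_scalar_det_class: "i_scalar \<in> det_class (- 1)"
  using i_scalar_symmetry by (simp add: det_class_def i_scalar_def)

lemma alpha_eq_block: "alpha = proj_map (block id2 i_scalar)"
proof -
  have "(\<chi> i j. if i = j then vector [1, 1, \<i>, \<i>] $ i else 0) = block id2 i_scalar"
    by (simp add: vec4_eq_iff block_def i_scalar_def Finite_Cartesian_Product.mat_def)
  then show ?thesis by (simp add: alpha_def)
qed

lemma invertible_alpha_block: "invertible (block id2 i_scalar)"
  by (intro invertible_block symmetry_invertible one_symmetry i_scalar_symmetry)

lemma alpha_graph_line: "alpha ` graph_line M = graph_line (i_scalar ** M)"
proof -
  have "i_scalar ** M ** matrix_inv id2 = i_scalar ** M"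
    using matrix_inv_mult(1)[OF one_symmetry, of id2] by simp
  then show ?thesis
    unfolding alpha_eq_block
    by (simp add: block_graph_line symmetry_invertible one_symmetry i_scalar_symmetry)
qed

lemma alpha_automorphism: "alpha \<in> proj_automorphisms schur"
proof -
  let ?A = "block id2 i_scalar"
  have inv: "schur (?A *v x) = schur x" for x
    by (rule schur_block[OF one_symmetry i_scalar_symmetry])
  note A = matrix_inv_vector[OF invertible_alpha_block]
  have "proj_map ?A ` zero_locus schur = zero_locus schur"
  proof (intro Set.set_eqI iffI)
    fix p assume "p \<in> proj_map ?A ` zero_locus schur"
    then obtain v where v: "v \<noteq> 0" "schur v = 0" "p = vec.span {?A *v v}"
      by (auto simp: zero_locus_def proj_map_span)
    then have "?A *v v \<noteq> 0" using A(2)[of v] by (metis matrix_vector_mult_0_right)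
    then show "p \<in> zero_locus schur" using v inv by (auto simp: zero_locus_def)
  next
    fix p assume "p \<in> zero_locus schur"
    then obtain v where v: "v \<noteq> 0" "schur v = 0" "p = vec.span {v}"
      by (auto simp: zero_locus_def)
    define w where "w = matrix_inv ?A *v v"
    have w: "?A *v w = v" by (simp add: w_def A(1))
    then have "w \<noteq> 0" "schur w = 0" using v inv[of w] by auto
    then have "vec.span {w} \<in> zero_locus schur" by (auto simp: zero_locus_def)
    moreover have "p = proj_map ?A (vec.span {w})" by (simp add: proj_map_span w v(3))
    ultimately show "p \<in> proj_map ?A ` zero_locus schur" by blast
  qed
  then show ?thesis
    unfolding proj_automorphisms_def alpha_eq_block using invertible_alpha_block by blast
qed

lemma i_scalar_det_class_image:
  assumes "e^2 = 1"
  shows "(**) i_scalar ` det_class e = det_class (- e)"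
proof (intro Set.set_eqI iffI)
  fix M assume M: "M \<in> det_class (- e)"
  have "i_scalar ** (matrix_inv i_scalar ** M) = M"
    by (rule matrix_inv_mult(2)[OF i_scalar_symmetry])
  moreover from this have "matrix_inv i_scalar ** M \<in> det_class e"
    using det_class_mult_iff[OF i_scalar_det_class, of "matrix_inv i_scalar ** M" e] M by simp
  ultimately show "M \<in> (**) i_scalar ` det_class e" by (metis imageI)
qed (use det_class_mult_iff[OF i_scalar_det_class, of _ e] in auto)

lemma push_alpha_lines:
  assumes "e^2 = 1"
  shows "push_divisor alpha (mset_set (graph_line ` det_class e))
     = mset_set (graph_line ` det_class (- e))"
proof -
  have "M = N" if "i_scalar ** M = i_scalar ** N" for M N
    using arg_cong[OF that, of "(**) (matrix_inv i_scalar)"]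
    by (simp add: matrix_inv_mult(1)[OF i_scalar_symmetry])
  then have "inj_on ((`) alpha) (graph_line ` S)" for S
    by (auto simp: inj_on_def alpha_graph_line)
  then have "push_divisor alpha (mset_set (graph_line ` det_class e))
     = mset_set ((`) alpha ` graph_line ` det_class e)"
    by (simp add: push_divisor_def image_mset_mset_set)
  also have "(`) alpha ` graph_line ` det_class e = graph_line ` (**) i_scalar ` det_class e"
    by (simp add: image_image alpha_graph_line)
  finally show ?thesis by (simp add: i_scalar_det_class_image[OF assms])
qed

lemma points_of_mult_push_alpha:
  "points_of_mult (push_divisor alpha D) r = alpha ` points_of_mult D r"
  (is "?L = ?R") and inj_alpha: "inj alpha"
proof -
  let ?A = "block id2 i_scalar"
  note A = matrix_inv_vector[OF invertible_alpha_block]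
  show inj: "inj alpha"
  proof (rule inj_on_inverseI[of _ "proj_map (matrix_inv ?A)"])
    fix p :: point
    show "proj_map (matrix_inv ?A) (alpha p) = p"
      by (simp add: alpha_eq_block proj_map_def image_image A)
  qed
  have P3: "alpha p \<in> P3 \<longleftrightarrow> p \<in> P3" for p
  proof -
    have P3_image: "proj_map B ` P3 \<subseteq> P3" if "invertible B" for B
      using proj_map_projectivization[OF that, of UNIV] unfolding P3_def
      by (auto simp: projectivization_def)
    have "p = proj_map (matrix_inv ?A) (alpha p)"
      by (simp add: alpha_eq_block proj_map_def image_image A)
    then show ?thesis
      using P3_image[OF invertible_alpha_block]
        P3_image[OF invertible_matrix_inv[OF invertible_alpha_block]]
      unfolding alpha_eq_block by (metis image_subset_iff)
  qed
  have mult: "card {l \<in> set_mset (push_divisor alpha D). alpha p \<in> l}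
      = card {l \<in> set_mset D. p \<in> l}" for p
  proof -
    have "{l \<in> set_mset (push_divisor alpha D). alpha p \<in> l}
        = (`) alpha ` {l \<in> set_mset D. p \<in> l}"
      by (auto simp: push_divisor_def dest: injD[OF inj])
    moreover have "inj_on ((`) alpha) {l \<in> set_mset D. p \<in> l}"
      using inj by (simp add: inj_on_def inj_image_eq_iff)
    ultimately show ?thesis by (simp add: card_image)
  qed
  have surj: "\<exists>q. p = alpha q" for p
    by (rule exI[of _ "proj_map (matrix_inv ?A) p"])
       (simp add: alpha_eq_block proj_map_def image_image A)
  show "?L = ?R"
  proof (intro Set.set_eqI iffI)
    fix p assume "p \<in> ?L"
    moreover obtain q where "p = alpha q" using surj by blast
    ultimately show "p \<in> ?R" by (auto simp: points_of_mult_def P3 mult)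
  qed (auto simp: points_of_mult_def P3 mult)
qed

lemma incidence_data_push_alpha:
  assumes "incidence_data D n t2 t3 t4"
  shows "incidence_data (push_divisor alpha D) n t2 t3 t4"
proof -
  have "inj_on ((`) alpha) (set_mset D)"
    using inj_alpha by (simp add: inj_on_def inj_image_eq_iff)
  then have "card (set_mset (push_divisor alpha D)) = card (set_mset D)"
    by (simp add: push_divisor_def card_image)
  moreover have "card (alpha ` S) = card S" for S
    using inj_alpha by (metis card_image inj_on_subset subset_UNIV)
  ultimately show ?thesis
    using assms by (simp add: incidence_data_def points_of_mult_push_alpha)
qed

section \<open>Incidence data\<close>

text \<open>
  In the subgroup only the four triple axes have a nontrivial stabilizer, so there are
  $24 \cdot 4 / 3$ triple points and no double points.
\<close>

lemma incidence_data_half_group: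
  assumes D: "set_mset D = graph_line ` det_class 1"
  shows "incidence_data D 24 0 32 0"
proof -
  have empty: "points_of_mult D r = {}" if "r \<in> {2, 4}" for r
  proof -
    have "card (fixing (det_class 1) v) \<noteq> r" if "v \<noteq> 0" for v
      using \<open>r \<in> {2, 4}\<close> by (cases rule: axis_cases[OF that]) auto
    then show ?thesis
      using points_of_mult_group[OF matrix_group_det_class D, of r] that by auto
  qed
  have "finite (points_of_mult D 3)
    \<and> 3 * card (points_of_mult D 3) = card (det_class 1) * card triple_axes"
  proof -
    have axis: "\<rho> \<noteq> 0 \<and> card (fixing (det_class 1) \<rho>) = 3" if "\<rho> \<in> triple_axes" for \<rho>
      using axis_nonzero[of \<rho>] fixing_triple_axis(1)[of \<rho> 1 \<rho>] that by simp
    have cover: "\<exists>k. \<exists>\<rho>\<in>triple_axes. v = k *s \<rho>" if v: "v \<noteq> 0" "card (fixing (det_class 1) v) = 3" for v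
      using v(2) by (cases rule: axis_cases[OF v(1)]) auto
    show ?thesis
      by (intro conjI card_points_of_mult[OF matrix_group_det_class D _
            det_class_finite_card(1)[of 1] finite_axes(1) axis cover triple_axes_unique])
        (assumption | simp)+
  qed
  then show ?thesis
    using empty[of 2] empty[of 4] det_class_finite_card(2)[of 1]
    by (simp add: incidence_data_def D card_image inj_on_def card_axes)
qed

text \<open>
  In the whole group there are $48 \cdot 4 / 3$ triple points and $48 \cdot 6 / 2$ double points.
\<close>

lemma incidence_data_all:
  assumes D: "set_mset D = graph_line ` symmetries"
  shows "incidence_data D 48 144 64 0"
proof -
  have empty: "points_of_mult D 4 = {}"
  proof -
    have "card (fixing symmetries v) \<noteq> 4" if "v \<noteq> 0" for v
      unfolding card_fixing_symmetries by (cases rule: axis_cases[OF that]) auto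
    then show ?thesis using points_of_mult_group[OF matrix_group_symmetries D, of 4] by auto
  qed
  have 3: "finite (points_of_mult D 3)
    \<and> 3 * card (points_of_mult D 3) = card symmetries * card triple_axes"
  proof -
    have axis: "\<rho> \<noteq> 0 \<and> card (fixing symmetries \<rho>) = 3" if "\<rho> \<in> triple_axes" for \<rho>
      using axis_nonzero[of \<rho>] card_fixing_triple_axis that by simp
    have cover: "\<exists>k. \<exists>\<rho>\<in>triple_axes. v = k *s \<rho>" if v: "v \<noteq> 0" "card (fixing symmetries v) = 3" for v
      using v(2) unfolding card_fixing_symmetries by (cases rule: axis_cases[OF v(1)]) auto
    show ?thesis
      by (intro conjI card_points_of_mult[OF matrix_group_symmetries D _
            symmetries_finite_card(1) finite_axes(1) axis cover triple_axes_unique])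
        (assumption | simp)+
  qed
  have 2: "finite (points_of_mult D 2)
    \<and> 2 * card (points_of_mult D 2) = card symmetries * card double_axes"
  proof -
    have axis: "\<rho> \<noteq> 0 \<and> card (fixing symmetries \<rho>) = 2" if "\<rho> \<in> double_axes" for \<rho>
      unfolding card_fixing_symmetries
      using axis_nonzero[of \<rho>] fixing_double_axis[of \<rho> 1 \<rho>] that by simp
    have cover: "\<exists>k. \<exists>\<rho>\<in>double_axes. v = k *s \<rho>" if v: "v \<noteq> 0" "card (fixing symmetries v) = 2" for v
      using v(2) unfolding card_fixing_symmetries by (cases rule: axis_cases[OF v(1)]) auto
    show ?thesis
      by (intro conjI card_points_of_mult[OF matrix_group_symmetries D _
            symmetries_finite_card(1) finite_axes(2) axis cover double_axes_unique])
        (assumption | simp)+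
  qed
  from 2 3 empty show ?thesis
    by (simp add: incidence_data_def D card_image inj_on_def card_axes symmetries_finite_card)
qed

text \<open>
  Two matrices agreeing on two independent vectors are equal.
\<close>

lemma graph_lines_meet_once:
  assumes "M \<noteq> N" "p \<in> graph_line M" "p \<in> graph_line N"
  shows "graph_line M \<inter> graph_line N = {p}"
proof -
  have line: "\<exists>v. v \<noteq> 0 \<and> q = vec.span {join v (M *v v)} \<and> M *v v = N *v v"
    if "q \<in> graph_line M" "q \<in> graph_line N" for q
  proof -
    from that(1) obtain x where x: "x \<in> graph M" "x \<noteq> 0" "q = vec.span {x}"
      by (auto simp: graph_line_def projectivization_def)
    have "lower x = M *v upper x" "lower x = N *v upper x"
      using that x(2) span_mem_graph_line unfolding x(3) by blast+
    moreover from this x(2) have "upper x \<noteq> 0"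
      by (metis join_eq_0_iff join_upper_lower(3) matrix_vector_mult_0_right)
    moreover have "x = join (upper x) (lower x)" by simp
    ultimately show ?thesis using x(3) by metis
  qed
  obtain v where v: "v \<noteq> 0" "p = vec.span {join v (M *v v)}" "M *v v = N *v v"
    using line assms(2,3) by blast
  have "q = p" if q: "q \<in> graph_line M" "q \<in> graph_line N" for q
  proof -
    obtain w where w: "w \<noteq> 0" "q = vec.span {join w (M *v w)}" "M *v w = N *v w"
      using line q by blast
    define E where "E = v$1 * w$2 - v$2 * w$1"
    have "E = 0"
    proof (rule ccontr)
      assume "E \<noteq> 0"
      have "M *v u = N *v u" for u
      proof -
        have "u = ((u$1 * w$2 - u$2 * w$1) / E) *s v + ((v$1 * u$2 - v$2 * u$1) / E) *s w"
          using cramer_pair[of v w u] \<open>E \<noteq> 0\<close> unfolding E_def by simp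
        then show ?thesis using v(3) w(3) by (metis linear_mult_matrix)
      qed
      then show False using assms(1) by (simp add: matrix_eq)
    qed
    then obtain k where k: "w = k *s v"
      using multiple_if_cross_zero[OF v(1)] unfolding E_def by blast
    then have "k \<noteq> 0" using w(1) by auto
    moreover have "join w (M *v w) = k *s join v (M *v v)"
      by (simp add: k join_linear vector_scalar_commute)
    moreover have "join w (M *v w) \<noteq> 0" using w(1) by simp
    ultimately show "q = p" unfolding w(2) v(2) using span_eq_span_iff by blast
  qed
  then show ?thesis using assms(2,3) by blast
qed

theorem proposition4p1:
  fixes \<tau> :: complex and D Dstar :: line_divisor
  assumes "\<tau>\<^sup>2 = -3"
    and "D = half \<tau>"
    and "Dstar = push_divisor alpha D"
  shows "alpha \<in> proj_automorphisms schur
    \<and> set_mset D \<subseteq> lines_on schur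
    \<and> set_mset D \<inter> set_mset Dstar = {}
    \<and> set_mset (D + Dstar) = {l \<in> lines_on schur. first_kind schur l}
    \<and> incidence_data D 24 0 32 0
    \<and> incidence_data Dstar 24 0 32 0
    \<and> incidence_data (D + Dstar) 48 144 64 0
    \<and> points_of_mult (D + Dstar) 3 = points_of_mult D 3 \<union> points_of_mult Dstar 3
    \<and> points_of_mult D 3 \<inter> points_of_mult Dstar 3 = {}
    \<and> (\<forall>p \<in> points_of_mult (D + Dstar) 2.
          \<exists>l \<in> set_mset D. \<exists>l' \<in> set_mset Dstar. l \<inter> l' = {p})
    \<and> push_divisor alpha D = Dstar
    \<and> push_divisor alpha Dstar = D
    \<and> (\<exists>\<sigma> \<in> proj_automorphisms schur. push_divisor \<sigma> D = Dstar)"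
proof -
  have D_eq: "D = mset_set (graph_line ` det_class 1)"
    using assms by (simp add: half_eq)
  have Dstar_eq: "Dstar = mset_set (graph_line ` det_class (- 1))"
    using assms(3) push_alpha_lines[of 1] by (simp add: D_eq)
  have push_back: "push_divisor alpha Dstar = D"
    using push_alpha_lines[of "- 1"] by (simp add: D_eq Dstar_eq)
  have sets: "set_mset D = graph_line ` det_class 1" "set_mset Dstar = graph_line ` det_class (- 1)"
    using det_class_finite_card(1)[of 1] det_class_finite_card(1)[of "- 1"]
    by (simp_all add: D_eq Dstar_eq)
  have all: "set_mset (D + Dstar) = graph_line ` symmetries"
    unfolding symmetries_eq_det_classes(1) by (simp add: sets image_Un)
  have data_D: "incidence_data D 24 0 32 0" by (rule incidence_data_half_group[OF sets(1)])
  have data_Dstar: "incidence_data Dstar 24 0 32 0"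
    unfolding assms(3) by (rule incidence_data_push_alpha[OF data_D])
  have disjoint: "set_mset D \<inter> set_mset Dstar = {}"
    using symmetries_eq_det_classes(2) by (auto simp: sets)
  define n where "n e p = card {l \<in> graph_line ` det_class e. p \<in> l}" for e p
  have mult: "card {l \<in> set_mset D. p \<in> l} = n 1 p" "card {l \<in> set_mset Dstar. p \<in> l} = n (- 1) p"
    "card {l \<in> set_mset (D + Dstar). p \<in> l} = n 1 p + n (- 1) p" for p
  proof -
    show 1: "card {l \<in> set_mset D. p \<in> l} = n 1 p" "card {l \<in> set_mset Dstar. p \<in> l} = n (- 1) p"
      by (simp_all add: n_def sets)
    have "{l \<in> set_mset (D + Dstar). p \<in> l} = {l \<in> set_mset D. p \<in> l} \<union> {l \<in> set_mset Dstar. p \<in> l}"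
      by auto
    moreover have "{l \<in> set_mset D. p \<in> l} \<inter> {l \<in> set_mset Dstar. p \<in> l} = {}"
      using disjoint by auto
    ultimately show "card {l \<in> set_mset (D + Dstar). p \<in> l} = n 1 p + n (- 1) p"
      using 1 by (simp add: card_Un_disjoint)
  qed
  have types: "(n 1 p, n (- 1) p) \<in> {(0, 0), (1, 0), (0, 1), (1, 1), (3, 0), (0, 3)}" if p: "p \<in> P3" for p
  proof -
    obtain x where x: "x \<noteq> 0" "p = vec.span {x}" using p by (rule P3_cases)
    show ?thesis
      using lines_of_classes_through[OF x(1)] by (simp add: n_def x card_lines_through)
  qed
  have triple: "points_of_mult (D + Dstar) 3 = points_of_mult D 3 \<union> points_of_mult Dstar 3"
    "points_of_mult D 3 \<inter> points_of_mult Dstar 3 = {}"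
    using types unfolding points_of_mult_def mult by fastforce+
  have double: "\<exists>l \<in> set_mset D. \<exists>l' \<in> set_mset Dstar. l \<inter> l' = {p}"
    if p: "p \<in> points_of_mult (D + Dstar) 2" for p
  proof -
    have "p \<in> P3" "n 1 p + n (- 1) p = 2" using p unfolding points_of_mult_def mult by simp_all
    with types[of p] have "n 1 p = 1" "n (- 1) p = 1" by auto
    then have "{l \<in> graph_line ` det_class 1. p \<in> l} \<noteq> {}"
      "{l \<in> graph_line ` det_class (- 1). p \<in> l} \<noteq> {}"
      unfolding n_def by (metis card.empty zero_neq_one)+
    then obtain M N where M: "M \<in> det_class 1" "p \<in> graph_line M"
      and N: "N \<in> det_class (- 1)" "p \<in> graph_line N" by blast
    then have "M \<noteq> N" using symmetries_eq_det_classes(2) by auto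
    from graph_lines_meet_once[OF this M(2) N(2)] show ?thesis using M N by (auto simp: sets)
  qed
  show ?thesis
    using alpha_automorphism disjoint data_D data_Dstar incidence_data_all[OF all] triple double
      push_back assms(3) lines_of_first_kind all
    by (auto simp: sets det_class_def graph_line_mem_lines_on)
qed

end
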